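(* For every integer $n \geq 3$ there is a constant $c_n$ depending only on $n$ such that for every bounded convex domain $\Omega \subset \mathbb{R}^n$ and every $f:\overline{\Omega} \to \mathbb{R}$, continuous on $\overline\Omega$ and $C^2$ in $\Omega$, satisfying $\Delta f \geq 0$ in $\Omega$ and $f|_{\partial \Omega} \geq 0$, we have $$ \int_{\Omega} f \, d\mathcal{H}^n \leq c_n |\Omega|^{1/n} \int_{\partial \Omega} f \, d\mathcal{H}^{n-1}.$$
   Context: A domain is a nonempty connected open set. $\mathcal{H}^k$ is the $k$-dimensional Hausdorff measure and $|\Omega| = \mathcal{H}^n(\Omega)$. *)

theory Defs
  imports "HOL-Analysis.Analysis"
begin

section \<open>Hausdorff measure\<close>

(* Contribution of one covering set: \<omega>_k (diam U / 2)^k, with \<omega>_k the volume of the unit ball of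
   R^k, so that H^n is Lebesgue measure on R^n. The empty set has weight 0 also for k = 0. *)
definition hausdorff_weight :: "nat \<Rightarrow> 'a::metric_space set \<Rightarrow> ennreal" where
  "hausdorff_weight k U =
     (if U = {} then 0 else ennreal (unit_ball_vol (real k) * (diameter U / 2) ^ k))"

(* Boundedness is required explicitly because diameter is a junk value on unbounded sets. *)
definition hausdorff_pre :: "nat \<Rightarrow> real \<Rightarrow> 'a::metric_space set \<Rightarrow> ennreal" where
  "hausdorff_pre k \<delta> A =
     (INF U \<in> {U :: nat \<Rightarrow> 'a set. A \<subseteq> (\<Union>i. U i) \<and> (\<forall>i. bounded (U i) \<and> diameter (U i) \<le> \<delta>)}.
        \<Sum>i. hausdorff_weight k (U i))"

definition hausdorff_outer :: "nat \<Rightarrow> 'a::metric_space set \<Rightarrow> ennreal" where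
  "hausdorff_outer k A = (SUP \<delta> \<in> {0<..}. hausdorff_pre k \<delta> A)"

(* measure_of yields the null measure when its last argument is not countably additive on the
   given sets; emeasure_hausdorff_measure below shows that this does not happen here. *)
definition hausdorff_measure :: "nat \<Rightarrow> 'a::metric_space measure" where
  "hausdorff_measure k = measure_of UNIV (sets borel) (hausdorff_outer k)"

lemma sets_hausdorff_measure [simp, measurable_cong]: "sets (hausdorff_measure k) = sets borel"
  unfolding hausdorff_measure_def
  by (metis sets.sets_measure_of_eq space_borel)

lemma space_hausdorff_measure [simp]: "space (hausdorff_measure k) = UNIV"
  unfolding hausdorff_measure_def by (simp add: space_measure_of_conv)

lemma hausdorff_weight_empty [simp]: "hausdorff_weight k {} = 0"
  by (simp add: hausdorff_weight_def)

lemma hausdorff_weight_mono: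
  assumes "U \<subseteq> V" "bounded V"
  shows "hausdorff_weight k U \<le> hausdorff_weight k V"
proof (cases "U = {}")
  case False
  have "0 \<le> diameter U" "diameter U \<le> diameter V"
    using diameter_ge_0[OF bounded_subset[OF assms(2,1)]] diameter_subset[OF assms] by auto
  then have "unit_ball_vol (real k) * (diameter U / 2) ^ k \<le> unit_ball_vol (real k) * (diameter V / 2) ^ k"
    by (intro mult_left_mono power_mono) auto
  moreover have "V \<noteq> {}" using False assms(1) by blast
  ultimately show ?thesis using False
    by (simp add: hausdorff_weight_def ennreal_leI)
qed simp

lemma hausdorff_pre_eq_outer_measure:
  fixes A :: "'a::metric_space set" and k :: nat and \<delta> :: real
  assumes "\<delta> > 0"
  defines "g \<equiv> \<lambda>U :: 'a set. if bounded U \<and> diameter U \<le> \<delta> then hausdorff_weight k U else \<infinity>"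
  shows "positive (Pow UNIV) g" "increasing (Pow UNIV) g"
    "hausdorff_pre k \<delta> A = outer_measure (Pow UNIV) g A"
proof -
  show pos: "positive (Pow UNIV) g"
    using assms by (simp add: positive_def)
  show inc: "increasing (Pow UNIV) g"
    unfolding increasing_def
  proof (intro ballI impI)
    fix U V :: "'a set" assume UV: "U \<subseteq> V"
    show "g U \<le> g V"
    proof (cases "bounded V \<and> diameter V \<le> \<delta>")
      case True
      then have "bounded U" "diameter U \<le> \<delta>"
        using bounded_subset[OF _ UV] diameter_subset[OF UV] by auto
      then show ?thesis using True hausdorff_weight_mono[OF UV] by (simp add: g_def)
    next
      case False
      then have "g V = \<infinity>" unfolding g_def by (rule if_not_P)
      then show ?thesis by simp
    qed
  qed
  show "hausdorff_pre k \<delta> A = outer_measure (Pow UNIV) g A"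
  proof (rule antisym)
    show "outer_measure (Pow UNIV) g A \<le> hausdorff_pre k \<delta> A"
      unfolding hausdorff_pre_def
    proof (rule INF_greatest, clarify)
      fix U :: "nat \<Rightarrow> 'a set"
      assume U: "A \<subseteq> (\<Union>i. U i)" "\<forall>i. bounded (U i) \<and> diameter (U i) \<le> \<delta>"
      have "outer_measure (Pow UNIV) g A \<le> (\<Sum>i. g (U i))"
        using ring_of_sets.outer_measure_le[OF ring_of_sets_Pow pos inc _ U(1)] by simp
      also have "\<dots> = (\<Sum>i. hausdorff_weight k (U i))"
        using U(2) by (simp add: g_def)
      finally show "outer_measure (Pow UNIV) g A \<le> (\<Sum>i. hausdorff_weight k (U i))" .
    qed
    show "hausdorff_pre k \<delta> A \<le> outer_measure (Pow UNIV) g A"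
      unfolding outer_measure_def
    proof (rule INF_greatest, clarify)
      fix U :: "nat \<Rightarrow> 'a set"
      assume U: "A \<subseteq> (\<Union>i. U i)"
      show "hausdorff_pre k \<delta> A \<le> (\<Sum>i. g (U i))"
      proof (cases "\<forall>i. bounded (U i) \<and> diameter (U i) \<le> \<delta>")
        case True
        then have "(\<Sum>i. g (U i)) = (\<Sum>i. hausdorff_weight k (U i))"
          by (simp add: g_def)
        then show ?thesis
          unfolding hausdorff_pre_def using U True by (intro INF_lower2[of U]) auto
      next
        case False
        then obtain i where "\<not> (bounded (U i) \<and> diameter (U i) \<le> \<delta>)" by blast
        then have "g (U i) = \<infinity>" unfolding g_def by (rule if_not_P)
        moreover have "g (U i) \<le> (\<Sum>i. g (U i))"
          using sum_le_suminf[of "\<lambda>i. g (U i)" "{i}"] by simp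
        ultimately show ?thesis by (simp add: top_unique)
      qed
    qed
  qed
qed

lemma hausdorff_pre_antimono:
  fixes A :: "'a::metric_space set"
  assumes "\<delta> \<le> \<epsilon>"
  shows "hausdorff_pre k \<epsilon> A \<le> hausdorff_pre k \<delta> A"
  unfolding hausdorff_pre_def proof (rule INF_superset_mono[OF _ order_refl], rule Collect_mono, intro impI)
  fix U :: "nat \<Rightarrow> 'a set"
  assume U: "A \<subseteq> (\<Union>i. U i) \<and> (\<forall>i. bounded (U i) \<and> diameter (U i) \<le> \<delta>)"
  have "diameter (U i) \<le> \<epsilon>" for i
    using U assms order_trans by blast
  with U show "A \<subseteq> (\<Union>i. U i) \<and> (\<forall>i. bounded (U i) \<and> diameter (U i) \<le> \<epsilon>)"
    by blast
qed

lemma hausdorff_pre_le_outer: "\<delta> > 0 \<Longrightarrow> hausdorff_pre k \<delta> A \<le> hausdorff_outer k A"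
  unfolding hausdorff_outer_def by (intro SUP_upper) auto

lemma outer_measure_space_hausdorff_pre:
  assumes "\<delta> > 0"
  shows "outer_measure_space (Pow UNIV) (hausdorff_pre k \<delta> :: 'a::metric_space set \<Rightarrow> ennreal)"
proof -
  have "(hausdorff_pre k \<delta> :: 'a set \<Rightarrow> ennreal) = outer_measure (Pow UNIV)
      (\<lambda>U. if bounded U \<and> diameter U \<le> \<delta> then hausdorff_weight k U else \<infinity>)"
    using hausdorff_pre_eq_outer_measure(3)[OF assms] by blast
  then show ?thesis
    using ring_of_sets.outer_measure_space_outer_measure[OF ring_of_sets_Pow
        hausdorff_pre_eq_outer_measure(1,2)[OF assms]] by simp
qed

lemma outer_measure_space_hausdorff:
  "outer_measure_space (Pow UNIV) (hausdorff_outer k :: 'a::metric_space set \<Rightarrow> ennreal)"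
  unfolding outer_measure_space_def
proof (intro conjI)
  have oms: "positive (Pow UNIV) (hausdorff_pre k \<delta> :: 'a set \<Rightarrow> ennreal)"
    "increasing (Pow UNIV) (hausdorff_pre k \<delta> :: 'a set \<Rightarrow> ennreal)"
    "countably_subadditive (Pow UNIV) (hausdorff_pre k \<delta> :: 'a set \<Rightarrow> ennreal)" if "\<delta> > 0" for \<delta>
    using outer_measure_space_hausdorff_pre[OF that, of k]
    unfolding outer_measure_space_def by blast+
  show "positive (Pow UNIV) (hausdorff_outer k :: 'a set \<Rightarrow> ennreal)"
  proof -
    have "hausdorff_pre k \<delta> ({} :: 'a set) = 0" if "\<delta> > 0" for \<delta>
      using oms(1)[OF that] by (simp add: positive_def)
    then have "hausdorff_outer k ({} :: 'a set) = (SUP \<delta> \<in> {0::real<..}. 0)"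
      unfolding hausdorff_outer_def by (intro SUP_cong) auto
    then show ?thesis by (simp add: positive_def)
  qed
  show "increasing (Pow UNIV) (hausdorff_outer k :: 'a set \<Rightarrow> ennreal)"
    unfolding increasing_def hausdorff_outer_def
  proof (intro ballI impI SUP_mono)
    fix A B :: "'a set" and \<delta> :: real assume "A \<subseteq> B" "\<delta> \<in> {0<..}"
    then have "hausdorff_pre k \<delta> A \<le> hausdorff_pre k \<delta> B"
      using oms(2)[of \<delta>] by (simp add: increasing_def)
    with \<open>\<delta> \<in> {0<..}\<close> show "\<exists>\<epsilon>\<in>{0<..}. hausdorff_pre k \<delta> A \<le> hausdorff_pre k \<epsilon> B" by blast
  qed
  show "countably_subadditive (Pow UNIV) (hausdorff_outer k :: 'a set \<Rightarrow> ennreal)"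
    unfolding countably_subadditive_def
  proof (intro allI impI)
    fix A :: "nat \<Rightarrow> 'a set"
    assume A: "range A \<subseteq> Pow UNIV" "disjoint_family A"
    have "hausdorff_pre k \<delta> (\<Union>i. A i) \<le> (\<Sum>i. hausdorff_outer k (A i))" if "\<delta> > 0" for \<delta>
    proof -
      have "hausdorff_pre k \<delta> (\<Union>i. A i) \<le> (\<Sum>i. hausdorff_pre k \<delta> (A i))"
        using oms(3)[OF that] A by (auto simp: countably_subadditive_def)
      also have "\<dots> \<le> (\<Sum>i. hausdorff_outer k (A i))"
        using that by (intro suminf_le hausdorff_pre_le_outer) auto
      finally show ?thesis .
    qed
    then show "hausdorff_outer k (\<Union>i. A i) \<le> (\<Sum>i. hausdorff_outer k (A i))"
      unfolding hausdorff_outer_def[of k "\<Union>i. A i"] by (intro SUP_least) auto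
  qed
qed

lemma hausdorff_outer_mono: "A \<subseteq> B \<Longrightarrow> hausdorff_outer k A \<le> hausdorff_outer k B"
  using outer_measure_space_hausdorff[of k]
  by (auto simp: outer_measure_space_def increasing_def)

lemma hausdorff_outer_empty [simp]: "hausdorff_outer k {} = 0"
  using outer_measure_space_hausdorff[of k]
  by (auto simp: outer_measure_space_def positive_def)

lemma hausdorff_outer_Un_le: "hausdorff_outer k (A \<union> B) \<le> hausdorff_outer k A + hausdorff_outer k B"
proof -
  have "subadditive (Pow UNIV) (hausdorff_outer k :: 'a set \<Rightarrow> ennreal)"
    using outer_measure_space_hausdorff[of k]
    by (metis outer_measure_space_def ring_of_sets.countably_subadditive_subadditive ring_of_sets_Pow)
  then have *: "hausdorff_outer k (A \<union> (B - A)) \<le> hausdorff_outer k A + hausdorff_outer k (B - A)"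
    by (rule subadditiveD) auto
  also have "\<dots> \<le> hausdorff_outer k A + hausdorff_outer k B"
    by (intro add_left_mono hausdorff_outer_mono) auto
  finally show ?thesis by simp
qed

lemma hausdorff_outer_UN_le:
  fixes A :: "nat \<Rightarrow> 'a::metric_space set"
  shows "hausdorff_outer k (\<Union>i. A i) \<le> (\<Sum>i. hausdorff_outer k (A i))"
proof -
  have "hausdorff_outer k (\<Union>i. disjointed A i) \<le> (\<Sum>i. hausdorff_outer k (disjointed A i))"
    using outer_measure_space_hausdorff[of k] disjoint_family_disjointed[of A]
    by (auto simp: outer_measure_space_def countably_subadditive_def)
  also have "\<dots> \<le> (\<Sum>i. hausdorff_outer k (A i))"
    by (intro suminf_le hausdorff_outer_mono disjointed_subset) auto
  finally show ?thesis by (simp add: UN_disjointed_eq)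
qed

lemma hausdorff_outer_separated:
  fixes A B :: "'a::metric_space set"
  assumes "d > 0" and d: "\<And>x y. x \<in> A \<Longrightarrow> y \<in> B \<Longrightarrow> d \<le> dist x y"
  shows "hausdorff_outer k A + hausdorff_outer k B \<le> hausdorff_outer k (A \<union> B)"
proof -
  have pre: "hausdorff_pre k \<delta> A + hausdorff_pre k \<delta> B \<le> hausdorff_outer k (A \<union> B)"
    if "0 < \<delta>" "\<delta> < d" for \<delta>
  proof -
    have "hausdorff_pre k \<delta> A + hausdorff_pre k \<delta> B \<le> hausdorff_pre k \<delta> (A \<union> B)"
      unfolding hausdorff_pre_def[of k \<delta> "A \<union> B"]
    proof (rule INF_greatest, clarify)
      fix U :: "nat \<Rightarrow> 'a set"
      assume U: "A \<union> B \<subseteq> (\<Union>i. U i)" "\<forall>i. bounded (U i) \<and> diameter (U i) \<le> \<delta>"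
      have sub: "hausdorff_pre k \<delta> C \<le> (\<Sum>i. hausdorff_weight k (U i \<inter> C))" if "C \<subseteq> A \<union> B" for C
        unfolding hausdorff_pre_def
      proof (intro INF_lower CollectI conjI allI)
        show "C \<subseteq> (\<Union>i. U i \<inter> C)" using U(1) that by blast
        show "bounded (U i \<inter> C)" for i using U(2) by (meson bounded_Int)
        show "diameter (U i \<inter> C) \<le> \<delta>" for i
          using U(2) by (meson diameter_subset inf_le1 order_trans)
      qed
      have w: "hausdorff_weight k (U i \<inter> A) + hausdorff_weight k (U i \<inter> B)
             \<le> hausdorff_weight k (U i)" for i
      proof -
        have bd: "bounded (U i)" and le: "diameter (U i) \<le> \<delta>" using U(2) by auto
        have "U i \<inter> A = {} \<or> U i \<inter> B = {}"
        proof (rule ccontr)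
          assume "\<not> ?thesis"
          then obtain x y where "x \<in> U i" "x \<in> A" "y \<in> U i" "y \<in> B" by blast
          then have "d \<le> diameter (U i)"
            using d diameter_bounded_bound[OF bd] by (meson order_trans)
          then show False using le that by simp
        qed
        then show ?thesis using hausdorff_weight_mono[OF _ bd] by auto
      qed
      have "hausdorff_pre k \<delta> A + hausdorff_pre k \<delta> B
          \<le> (\<Sum>i. hausdorff_weight k (U i \<inter> A)) + (\<Sum>i. hausdorff_weight k (U i \<inter> B))"
        by (intro add_mono sub) auto
      also have "\<dots> = (\<Sum>i. hausdorff_weight k (U i \<inter> A) + hausdorff_weight k (U i \<inter> B))"
        by (rule suminf_add) auto
      also have "\<dots> \<le> (\<Sum>i. hausdorff_weight k (U i))"
        by (intro suminf_le w) auto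
      finally show "hausdorff_pre k \<delta> A + hausdorff_pre k \<delta> B \<le> (\<Sum>i. hausdorff_weight k (U i))" .
    qed
    also have "\<dots> \<le> hausdorff_outer k (A \<union> B)"
      by (rule hausdorff_pre_le_outer[OF that(1)])
    finally show ?thesis .
  qed
  have seq: "hausdorff_outer k C = (SUP n. hausdorff_pre k (d / real (n + 2)) C)" for C :: "'a set"
  proof (rule antisym)
    show "hausdorff_outer k C \<le> (SUP n. hausdorff_pre k (d / real (n + 2)) C)"
      unfolding hausdorff_outer_def
    proof (rule SUP_mono, clarify)
      fix \<delta> :: real assume \<delta>: "\<delta> > 0"
      obtain n where "d / \<delta> < real n" using reals_Archimedean2 by blast
      then have "d / real (n + 2) \<le> \<delta>" using \<delta> \<open>d > 0\<close> by (simp add: field_simps)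
      then show "\<exists>n\<in>UNIV. hausdorff_pre k \<delta> C \<le> hausdorff_pre k (d / real (n + 2)) C"
        using hausdorff_pre_antimono by blast
    qed
    show "(SUP n. hausdorff_pre k (d / real (n + 2)) C) \<le> hausdorff_outer k C"
      using \<open>d > 0\<close> by (intro SUP_least hausdorff_pre_le_outer) auto
  qed
  have inc: "incseq (\<lambda>n. hausdorff_pre k (d / real (n + 2)) C)" for C :: "'a set"
    using \<open>d > 0\<close> by (intro monoI hausdorff_pre_antimono divide_left_mono) auto
  have "hausdorff_outer k A + hausdorff_outer k B
      = (SUP n. hausdorff_pre k (d / real (n + 2)) A + hausdorff_pre k (d / real (n + 2)) B)"
    unfolding seq[of A] seq[of B] by (rule ennreal_SUP_add[OF inc inc, symmetric])
  also have "\<dots> \<le> hausdorff_outer k (A \<union> B)"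
    using \<open>d > 0\<close> by (intro SUP_least pre) (auto simp: field_simps add_pos_nonneg)
  finally show ?thesis .
qed

lemma hausdorff_outer_separated_family:
  fixes R :: "nat \<Rightarrow> 'a::metric_space set"
  assumes sep: "\<And>i. \<exists>d>0. \<forall>j>i. \<forall>x\<in>R i. \<forall>y\<in>R j. d \<le> dist x y"
    and sub: "\<And>i. R i \<subseteq> T"
  shows "(\<Sum>i. hausdorff_outer k (R i)) \<le> hausdorff_outer k T"
proof -
  have "(\<Sum>i<n. hausdorff_outer k (R (m + i))) \<le> hausdorff_outer k (\<Union>i<n. R (m + i))" for m n
  proof (induction n arbitrary: m)
    case (Suc n)
    obtain d where d: "d > 0" "\<forall>j>m. \<forall>x\<in>R m. \<forall>y\<in>R j. d \<le> dist x y" using sep by blast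
    have "(\<Sum>i<Suc n. hausdorff_outer k (R (m + i)))
        = hausdorff_outer k (R m) + (\<Sum>i<n. hausdorff_outer k (R (Suc m + i)))"
      by (subst sum.lessThan_Suc_shift) simp
    also have "\<dots> \<le> hausdorff_outer k (R m) + hausdorff_outer k (\<Union>i<n. R (Suc m + i))"
      by (rule add_left_mono[OF Suc.IH])
    also have "\<dots> \<le> hausdorff_outer k (R m \<union> (\<Union>i<n. R (Suc m + i)))"
    proof (rule hausdorff_outer_separated[OF d(1)])
      fix x y assume "x \<in> R m" "y \<in> (\<Union>i<n. R (Suc m + i))"
      then obtain i where "y \<in> R (Suc m + i)" by blast
      moreover have "Suc m + i > m" by simp
      ultimately show "d \<le> dist x y" using d(2) \<open>x \<in> R m\<close> by blast
    qed
    also have "R m \<union> (\<Union>i<n. R (Suc m + i)) = (\<Union>i<Suc n. R (m + i))"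
    proof -
      have "{..<Suc n} = insert 0 (Suc ` {..<n})" by (rule lessThan_Suc_eq_insert_0)
      then show ?thesis by (simp only: UN_insert UN_simps image_image add_0_right add_Suc_right add_Suc)
    qed
    finally show ?case .
  qed simp
  then have *: "(\<Sum>i<n. hausdorff_outer k (R (0 + i))) \<le> hausdorff_outer k (\<Union>i<n. R (0 + i))" for n .
  have "(\<Sum>i<n. hausdorff_outer k (R i)) \<le> hausdorff_outer k T" for n
  proof -
    have "(\<Union>i<n. R (0 + i)) \<subseteq> T" using sub by blast
    from order_trans[OF * hausdorff_outer_mono[OF this]] show ?thesis by simp
  qed
  then show ?thesis by (intro suminf_le_const) auto
qed

lemma closed_lambda_system_hausdorff:
  fixes C :: "'a::metric_space set"
  assumes "closed C"
  shows "C \<in> lambda_system UNIV (Pow UNIV) (hausdorff_outer k)"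
proof -
  have "hausdorff_outer k (T \<inter> C) + hausdorff_outer k (T - C) = hausdorff_outer k T" for T
  proof (rule antisym)
    show "hausdorff_outer k T \<le> hausdorff_outer k (T \<inter> C) + hausdorff_outer k (T - C)"
      using hausdorff_outer_Un_le[of k "T \<inter> C" "T - C"] by (simp add: Int_Diff_Un)
    show "hausdorff_outer k (T \<inter> C) + hausdorff_outer k (T - C) \<le> hausdorff_outer k T"
    proof (cases "hausdorff_outer k T = \<infinity> \<or> C = {}")
      case False
      then have fin: "hausdorff_outer k T < \<infinity>" and ne: "C \<noteq> {}" by (auto simp: top.not_eq_extremum)
      define E where "E n = {x \<in> T. infdist x C \<ge> 1 / real (Suc n)}" for n
      define R where "R n = E (Suc n) - E n" for n
      have Esub: "E n \<subseteq> T" for n by (auto simp: E_def)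
      have Rsub: "R n \<subseteq> T" for n by (auto simp: R_def E_def)
      have lip: "infdist x C - infdist y C \<le> dist x y" for x y
        using infdist_triangle[of x C y] by simp
      have Rsep: "\<exists>d>0. \<forall>j\<ge>Suc (Suc i). \<forall>x\<in>R i. \<forall>y\<in>R j. d \<le> dist x y" for i
      proof (intro exI[of _ "1 / real (Suc (Suc i)) - 1 / real (Suc (Suc (Suc i)))"] conjI allI impI ballI)
        show "0 < 1 / real (Suc (Suc i)) - 1 / real (Suc (Suc (Suc i)))"
          by (simp add: divide_strict_left_mono)
        fix j x y assume j: "Suc (Suc i) \<le> j" and x: "x \<in> R i" and y: "y \<in> R j"
        have "1 / real (Suc (Suc i)) \<le> infdist x C" using x by (simp add: R_def E_def)
        moreover have "infdist y C < 1 / real (Suc j)" using y by (auto simp: R_def E_def)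
        moreover have "1 / real (Suc j) \<le> 1 / real (Suc (Suc (Suc i)))"
          using j by (intro divide_left_mono) auto
        ultimately show "1 / real (Suc (Suc i)) - 1 / real (Suc (Suc (Suc i))) \<le> dist x y"
          using lip[of x y] by linarith
      qed
      have part: "(\<Sum>i. hausdorff_outer k (R (2 * i + c))) \<le> hausdorff_outer k T" for c
      proof (rule hausdorff_outer_separated_family)
        fix i
        obtain d where d: "d > 0" "\<forall>j\<ge>Suc (Suc (2 * i + c)). \<forall>x\<in>R (2 * i + c). \<forall>y\<in>R j. d \<le> dist x y"
          using Rsep by blast
        have "Suc (Suc (2 * i + c)) \<le> 2 * j + c" if "j > i" for j using that by simp
        then show "\<exists>d>0. \<forall>j>i. \<forall>x\<in>R (2 * i + c). \<forall>y\<in>R (2 * j + c). d \<le> dist x y"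
          using d by blast
      qed (rule Rsub)
      have "(\<Sum>i<n. hausdorff_outer k (R i)) \<le> hausdorff_outer k T + hausdorff_outer k T" for n
      proof -
        have "(\<Sum>i<n. hausdorff_outer k (R i)) \<le> (\<Sum>i<2 * n. hausdorff_outer k (R i))"
          by (intro sum_mono2) auto
        also have "\<dots> = (\<Sum>i<n. hausdorff_outer k (R (2 * i + 0))) + (\<Sum>i<n. hausdorff_outer k (R (2 * i + 1)))"
          by (induction n) (auto simp: algebra_simps)
        also have "\<dots> \<le> (\<Sum>i. hausdorff_outer k (R (2 * i + 0))) + (\<Sum>i. hausdorff_outer k (R (2 * i + 1)))"
          by (intro add_mono sum_le_suminf) auto
        also have "\<dots> \<le> hausdorff_outer k T + hausdorff_outer k T"
          by (intro add_mono part)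
        finally show ?thesis .
      qed
      then have "(\<Sum>i. hausdorff_outer k (R i)) \<le> hausdorff_outer k T + hausdorff_outer k T"
        by (intro suminf_le_const) auto
      also have "\<dots> < \<infinity>" using fin by simp
      finally have Rfin: "(\<Sum>i. hausdorff_outer k (R i)) < \<infinity>" .
      define r where "r n = (\<Sum>i. hausdorff_outer k (R (i + n)))" for n
      have r0: "r \<longlonglongrightarrow> 0"
      proof -
        have "(\<lambda>n. (\<Sum>i. hausdorff_outer k (R i)) - (\<Sum>i<n. hausdorff_outer k (R i)))
            \<longlonglongrightarrow> (\<Sum>i. hausdorff_outer k (R i)) - (\<Sum>i. hausdorff_outer k (R i))"
          using Rfin by (intro tendsto_diff_ennreal summable_LIMSEQ tendsto_const) auto
        moreover have "(\<Sum>i. hausdorff_outer k (R i)) - (\<Sum>i<n. hausdorff_outer k (R i)) = r n" for n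
        proof -
          have "(\<Sum>i. hausdorff_outer k (R i)) = r n + (\<Sum>i<n. hausdorff_outer k (R i))"
            unfolding r_def by (rule suminf_offset) auto
          moreover have "(\<Sum>i<n. hausdorff_outer k (R i)) < \<infinity>"
            by (rule le_less_trans[OF sum_le_suminf Rfin]) auto
          ultimately show ?thesis using ennreal_add_diff_cancel by (metis less_irrefl)
        qed
        ultimately show ?thesis using Rfin by simp
      qed
      have le: "hausdorff_outer k (T \<inter> C) + hausdorff_outer k (T - C) \<le> hausdorff_outer k T + r n" for n
      proof -
        have "T - C \<subseteq> E n \<union> (\<Union>i. R (i + n))"
        proof
          fix x assume x: "x \<in> T - C"
          then have pos: "infdist x C > 0"
            using in_closed_iff_infdist_zero[OF assms ne] infdist_nonneg[of x C] by fastforce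
          then obtain N where "inverse (real (Suc N)) < infdist x C"
            using reals_Archimedean by blast
          then have xN: "x \<in> E N" using x by (auto simp: E_def inverse_eq_divide)
          show "x \<in> E n \<union> (\<Union>i. R (i + n))"
          proof (cases "x \<in> E n")
            case False
            define m where "m = (LEAST m. x \<in> E m)"
            have m: "x \<in> E m" unfolding m_def using xN by (rule LeastI)
            have "m > n"
            proof (rule ccontr)
              assume "\<not> m > n"
              then have "1 / real (Suc n) \<le> 1 / real (Suc m)"
                by (intro divide_left_mono) auto
              then show False using m False by (auto simp: E_def)
            qed
            then obtain i where i: "m = Suc (i + n)"
              by (metis add.commute less_imp_Suc_add)
            have "x \<notin> E (i + n)"
              using not_less_Least[of "i + n" "\<lambda>m. x \<in> E m"] i by (simp add: m_def)
            then show ?thesis using m i by (auto simp: R_def)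
          qed simp
        qed
        then have "hausdorff_outer k (T - C) \<le> hausdorff_outer k (E n \<union> (\<Union>i. R (i + n)))"
          by (rule hausdorff_outer_mono)
        also have "\<dots> \<le> hausdorff_outer k (E n) + hausdorff_outer k (\<Union>i. R (i + n))"
          by (rule hausdorff_outer_Un_le)
        also have "\<dots> \<le> hausdorff_outer k (E n) + r n"
          unfolding r_def by (intro add_left_mono hausdorff_outer_UN_le)
        finally have 1: "hausdorff_outer k (T - C) \<le> hausdorff_outer k (E n) + r n" .
        have "hausdorff_outer k (T \<inter> C) + hausdorff_outer k (E n) \<le> hausdorff_outer k (T \<inter> C \<union> E n)"
        proof (rule hausdorff_outer_separated)
          show "0 < 1 / real (Suc n)" by simp
          fix x y assume "x \<in> T \<inter> C" "y \<in> E n"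
          then show "1 / real (Suc n) \<le> dist x y"
            using lip[of y x] by (auto simp: E_def dist_commute)
        qed
        also have "\<dots> \<le> hausdorff_outer k T"
          using Esub by (intro hausdorff_outer_mono) auto
        finally have 2: "hausdorff_outer k (T \<inter> C) + hausdorff_outer k (E n) \<le> hausdorff_outer k T" .
        have "hausdorff_outer k (T \<inter> C) + hausdorff_outer k (T - C)
            \<le> (hausdorff_outer k (T \<inter> C) + hausdorff_outer k (E n)) + r n"
          using add_left_mono[OF 1] by (simp add: add.assoc)
        also have "\<dots> \<le> hausdorff_outer k T + r n"
          by (rule add_right_mono[OF 2])
        finally show ?thesis .
      qed
      have "(\<lambda>n. hausdorff_outer k T + r n) \<longlonglongrightarrow> hausdorff_outer k T + 0"
        by (intro tendsto_add tendsto_const r0)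
      from LIMSEQ_le_const[OF this] show ?thesis using le by auto
    qed auto
  qed
  then show ?thesis
    by (simp add: lambda_system_def Int_commute Diff_eq)
qed

lemma emeasure_hausdorff_measure:
  fixes A :: "'a::metric_space set"
  assumes "A \<in> sets borel"
  shows "emeasure (hausdorff_measure k) A = hausdorff_outer k A"
proof -
  let ?L = "lambda_system UNIV (Pow UNIV) (hausdorff_outer k) :: 'a set set"
  have ms: "measure_space UNIV ?L (hausdorff_outer k)"
    by (rule sigma_algebra.caratheodory_lemma[OF sigma_algebra_Pow outer_measure_space_hausdorff])
  then have sa: "sigma_algebra UNIV ?L" by (simp add: measure_space_def)
  have "sets (borel :: 'a measure) = sigma_sets UNIV (Collect closed)"
    by (simp add: borel_eq_closed)
  also have "\<dots> \<subseteq> ?L"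
    by (rule sigma_algebra.sigma_sets_subset[OF sa]) (use closed_lambda_system_hausdorff in blast)
  finally have sub: "sets borel \<subseteq> ?L" .
  show ?thesis
    unfolding hausdorff_measure_def
  proof (rule emeasure_measure_of_sigma)
    show "sigma_algebra UNIV (sets (borel :: 'a measure))"
      by (metis sets.sigma_algebra_axioms space_borel)
    show "positive (sets borel) (hausdorff_outer k :: 'a set \<Rightarrow> ennreal)"
      by (simp add: positive_def)
    show "countably_additive (sets borel) (hausdorff_outer k :: 'a set \<Rightarrow> ennreal)"
      using ms sub unfolding measure_space_def countably_additive_def by blast
  qed (rule assms)
qed


section \<open>Partial derivatives, functions of class C^k, Laplacian\<close>

definition partial_deriv :: "'a::euclidean_space \<Rightarrow> ('a \<Rightarrow> real) \<Rightarrow> 'a \<Rightarrow> real" where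
  "partial_deriv b f x = deriv (\<lambda>t. f (x + t *\<^sub>R b)) 0"

(* Intended for open S: all partial derivatives of order at most k exist and are continuous on S. *)
primrec Ck_on :: "nat \<Rightarrow> ('a::euclidean_space \<Rightarrow> real) \<Rightarrow> 'a set \<Rightarrow> bool" where
  "Ck_on 0 f S \<longleftrightarrow> continuous_on S f"
| "Ck_on (Suc k) f S \<longleftrightarrow> continuous_on S f \<and>
     (\<forall>b\<in>Basis. (\<forall>x\<in>S. (\<lambda>t. f (x + t *\<^sub>R b)) differentiable (at 0)) \<and>
                Ck_on k (partial_deriv b f) S)"

definition laplacian :: "('a::euclidean_space \<Rightarrow> real) \<Rightarrow> 'a \<Rightarrow> real" where
  "laplacian f x = (\<Sum>b\<in>Basis. partial_deriv b (partial_deriv b f) x)"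

end

theory Submission
  imports Defs
begin

text \<open>
  The idea is to bound \<open>f\<close> from above by an explicit harmonic function built from half-space Poisson
  kernels; let \<open>n\<close> be the dimension. At a boundary point \<open>p\<close> of the convex domain take a supporting
  half-space with inner unit normal \<open>e\<close>, and put the pole \<open>q = p - r *\<^sub>R e\<close> slightly outside. The function
  \<open>x \<mapsto> r ^ (n - 1) * ((x - q) \<bullet> e) / norm (x - q) ^ n\<close> is harmonic away from \<open>q\<close>
  (\<open>dipole_harmonic\<close>), nonnegative on the closure of the domain because the domain lies in the
  half-space, and at least \<open>2 ^ (- n)\<close> on the part of the boundary within distance \<open>r\<close> of \<open>p\<close>
  (\<open>dipole_ge_near_pole\<close>). It is at most \<open>r ^ (n - 1) * norm (x - q) ^ (1 - n)\<close>, and the integral of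
  \<open>norm (x - q) ^ (1 - n)\<close> over a set of volume \<open>v\<close> is at most a constant times \<open>v powr (1 / n)\<close>
  (\<open>nn_integral_dist_power_le\<close>). Each such function therefore has integral at most a constant
  times \<open>v powr (1 / n) * r ^ (n - 1)\<close>.

  Cover the boundary by finitely many small balls with centres \<open>p\<close> on the boundary and radii \<open>r\<close>, and
  add the corresponding functions with weights \<open>2 ^ n * f p\<close>. Up to a small error, the sum dominates \<open>f\<close>
  on the boundary, hence in the domain by the maximum principle
  (\<open>subharmonic_le_0_of_frontier_le_0\<close>). The integral of \<open>f\<close> is thus at most a constant times
  \<open>v powr (1 / n)\<close> times the sum of all \<open>f p * r ^ (n - 1)\<close>. But such sums are precisely what Hausdorff
  measure is made of: the cover can be chosen so that the sum exceeds a constant multiple of the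
  boundary integral by as little as desired (\<open>exists_ball_cover_sum_le_integral\<close>). This requires
  the boundary to have finite measure, which holds because it is a nonexpansive image of the surface of
  a cube (\<open>hausdorff_outer_frontier_convex_finite\<close>).
\<close>

section \<open>Upper bounds for Hausdorff measures\<close>

text \<open>
  Upper bounds for a Hausdorff measure only need coverings at every scale: if the number of pieces
  grows like \<open>m ^ k\<close> while their diameter shrinks like \<open>1 / m\<close>, the total weight of dimension \<open>k\<close>
  stays bounded as \<open>m\<close> grows.
\<close>

lemma hausdorff_outer_le_of_covers:
  fixes A :: "'a::metric_space set" and k N :: nat
  assumes cov: "\<And>m::nat. m > 0 \<Longrightarrow> \<exists>\<U>. finite \<U> \<and> card \<U> \<le> N * m ^ k \<and> A \<subseteq> \<Union>\<U> \<and>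
                  (\<forall>U\<in>\<U>. bounded U \<and> diameter U \<le> L / real m)"
  shows "hausdorff_outer k A \<le> ennreal (real N * (unit_ball_vol (real k) * (L / 2) ^ k))"
  unfolding hausdorff_outer_def
proof (intro SUP_least)
  fix \<delta> :: real assume "\<delta> \<in> {0<..}"
  then have \<delta>: "\<delta> > 0" by simp
  obtain m0 :: nat where m0: "L / \<delta> < real m0" using reals_Archimedean2 by blast
  define m where "m = Suc m0"
  have m: "m > 0" by (simp add: m_def)
  have Lm: "L / real m \<le> \<delta>"
    using m0 \<delta> by (simp add: m_def field_simps)
  obtain \<U> where fin: "finite \<U>" and card: "card \<U> \<le> N * m ^ k" and A: "A \<subseteq> \<Union>\<U>"
    and \<U>: "\<And>U. U \<in> \<U> \<Longrightarrow> bounded U \<and> diameter U \<le> L / real m"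
    using cov[OF m] by blast
  obtain h where h: "bij_betw h {0..<card \<U>} \<U>"
    using ex_bij_betw_nat_finite[OF fin] by blast
  define U where "U i = (if i < card \<U> then h i else {})" for i
  have hU: "h i \<in> \<U>" if "i < card \<U>" for i
    using bij_betw_imp_surj_on[OF h] that by (metis atLeast0LessThan imageI lessThan_iff)
  have U: "bounded (U i) \<and> diameter (U i) \<le> \<delta>" for i
  proof (cases "i < card \<U>")
    case True
    then show ?thesis using \<U>[OF hU[OF True]] Lm by (simp add: U_def)
  qed (use \<delta> in \<open>simp add: U_def\<close>)
  have rng: "V \<in> range U" if "V \<in> \<U>" for V
  proof -
    obtain i where "i < card \<U>" "V = h i"
      using bij_betw_imp_surj_on[OF h] \<open>V \<in> \<U>\<close> by (metis atLeastLessThan_iff imageE)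
    then have "U i = V" by (simp add: U_def)
    then show ?thesis by blast
  qed
  have cover: "A \<subseteq> (\<Union>i. U i)"
    by (rule order_trans[OF A Union_mono]) (use rng in auto)
  have w: "hausdorff_weight k (U i) \<le> ennreal (unit_ball_vol (real k) * ((L / real m) / 2) ^ k)"
    if "i < card \<U>" for i
  proof -
    have "bounded (U i)" "diameter (U i) \<le> L / real m"
      using \<U>[OF hU[OF that]] that by (auto simp: U_def)
    then show ?thesis
      unfolding hausdorff_weight_def
      by (auto intro!: ennreal_leI mult_left_mono power_mono simp: diameter_ge_0)
  qed
  have Lpow: "0 \<le> (L / real m / 2) ^ k" if "card \<U> > 0"
  proof -
    have "0 \<le> L / real m"
      using \<U>[OF hU[OF that]] diameter_ge_0[of "h 0"] by linarith
    then show ?thesis by simp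
  qed
  have "hausdorff_pre k \<delta> A \<le> (\<Sum>i. hausdorff_weight k (U i))"
    unfolding hausdorff_pre_def using cover U by (intro INF_lower) auto
  also have "\<dots> = (\<Sum>i<card \<U>. hausdorff_weight k (U i))"
    by (intro suminf_finite) (auto simp: U_def)
  also have "\<dots> \<le> (\<Sum>i<card \<U>. ennreal (unit_ball_vol (real k) * ((L / real m) / 2) ^ k))"
    using w by (intro sum_mono) auto
  also have "\<dots> \<le> ennreal (real N * (unit_ball_vol (real k) * (L / 2) ^ k))"
  proof (cases "card \<U> > 0")
    case True
    have "(\<Sum>i<card \<U>. ennreal (unit_ball_vol (real k) * ((L / real m) / 2) ^ k))
        = ennreal (real (card \<U>) * (unit_ball_vol (real k) * ((L / real m) / 2) ^ k))"
      using Lpow[OF True] by (subst sum_ennreal) auto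
    also have "\<dots> \<le> ennreal (real (N * m ^ k) * (unit_ball_vol (real k) * ((L / real m) / 2) ^ k))"
      using Lpow[OF True] card by (intro ennreal_leI mult_right_mono) (auto simp del: of_nat_mult)
    also have "real (N * m ^ k) * (unit_ball_vol (real k) * ((L / real m) / 2) ^ k)
        = real N * (unit_ball_vol (real k) * (L / 2) ^ k)"
      using m by (simp add: power_divide)
    finally show ?thesis .
  qed simp
  finally show "hausdorff_pre k \<delta> A \<le> ennreal (real N * (unit_ball_vol (real k) * (L / 2) ^ k))" .
qed

text \<open>
  An axis-parallel cube whose sides are the directions in \<open>J\<close> is cut into a grid of mesh \<open>s / m\<close>. The
  cases needed are \<open>J = Basis\<close>, which bounds the measure of balls, and \<open>J = Basis - {i}\<close>, a face of
  the full-dimensional cube.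
\<close>

lemma hausdorff_outer_cube_le:
  fixes J :: "'a::euclidean_space set" and s :: real
  assumes J: "J \<subseteq> Basis" and s: "s > 0"
  shows "hausdorff_outer (card J)
           {x. (\<forall>b\<in>J. \<bar>(x - q) \<bullet> b\<bar> \<le> s) \<and> (\<forall>b\<in>Basis - J. x \<bullet> b = c b)}
         \<le> ennreal (3 ^ card J * (unit_ball_vol (real (card J)) * (DIM('a) * s / 2) ^ card J))"
    (is "hausdorff_outer _ ?A \<le> _")
proof -
  have finJ: "finite J" using J finite_Basis finite_subset by blast
  have "hausdorff_outer (card J) ?A
      \<le> ennreal (real (3 ^ card J) * (unit_ball_vol (real (card J)) * (DIM('a) * s / 2) ^ card J))"
  proof (rule hausdorff_outer_le_of_covers)
    fix m :: nat assume m: "m > 0"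
    \<comment> \<open>A cell is indexed by the integer parts of the rescaled coordinates, which lie between
      \<open>- m\<close> and \<open>m\<close>; the crude bound \<open>2 * m + 1 \<le> 3 * m\<close> gives the factor \<open>3 ^ card J\<close>.\<close>
    define \<Phi> where "\<Phi> = (PiE J (\<lambda>_. {- int m..int m}))"
    define cell where "cell \<phi> = {x\<in>?A. \<forall>b\<in>J. \<lfloor>(x - q) \<bullet> b * m / s\<rfloor> = \<phi> b}" for \<phi>
    have fin\<Phi>: "finite \<Phi>" unfolding \<Phi>_def using finJ by (intro finite_PiE) auto
    have card\<Phi>: "card \<Phi> \<le> 3 ^ card J * m ^ card J"
    proof -
      have "card \<Phi> = (2 * m + 1) ^ card J"
        unfolding \<Phi>_def using finJ by (simp add: card_PiE nat_add_distrib nat_mult_distrib)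
      also have "\<dots> \<le> (3 * m) ^ card J" using m by (intro power_mono) auto
      finally show ?thesis by (simp add: power_mult_distrib)
    qed
    have diam: "dist x y \<le> DIM('a) * s / m" if "x \<in> cell \<phi>" "y \<in> cell \<phi>" for x y \<phi>
    proof -
      have "\<bar>(x - y) \<bullet> b\<bar> \<le> s / m" if b: "b \<in> Basis" for b
      proof (cases "b \<in> J")
        case True
        then have "\<lfloor>(x - q) \<bullet> b * m / s\<rfloor> = \<lfloor>(y - q) \<bullet> b * m / s\<rfloor>"
          using \<open>x \<in> cell \<phi>\<close> \<open>y \<in> cell \<phi>\<close> by (simp add: cell_def)
        then have "\<bar>(x - q) \<bullet> b * m / s - (y - q) \<bullet> b * m / s\<bar> \<le> 1" by linarith
        also have "(x - q) \<bullet> b * m / s - (y - q) \<bullet> b * m / s = (x - y) \<bullet> b * m / s"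
          by (simp add: inner_diff_left diff_divide_distrib algebra_simps)
        finally show ?thesis using m s by (simp add: abs_mult field_simps)
      next
        case False
        then have "(x - y) \<bullet> b = 0"
          using \<open>x \<in> cell \<phi>\<close> \<open>y \<in> cell \<phi>\<close> b by (auto simp: cell_def inner_diff_left)
        then show ?thesis using s by simp
      qed
      then have "(\<Sum>b\<in>Basis. \<bar>(x - y) \<bullet> b\<bar>) \<le> (\<Sum>b\<in>(Basis::'a set). s / m)"
        by (intro sum_mono)
      then show ?thesis using norm_le_l1[of "x - y"] by (simp add: dist_norm)
    qed
    show "\<exists>\<U>. finite \<U> \<and> card \<U> \<le> 3 ^ card J * m ^ card J \<and> ?A \<subseteq> \<Union>\<U> \<and>
            (\<forall>U\<in>\<U>. bounded U \<and> diameter U \<le> DIM('a) * s / m)"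
    proof (intro exI[of _ "cell ` \<Phi>"] conjI ballI)
      show "finite (cell ` \<Phi>)" using fin\<Phi> by simp
      show "card (cell ` \<Phi>) \<le> 3 ^ card J * m ^ card J"
        using card_image_le[OF fin\<Phi>] card\<Phi> order_trans by blast
      show "?A \<subseteq> \<Union> (cell ` \<Phi>)"
      proof
        fix x assume x: "x \<in> ?A"
        define \<phi> where "\<phi> = restrict (\<lambda>b. \<lfloor>(x - q) \<bullet> b * m / s\<rfloor>) J"
        have "\<lfloor>(x - q) \<bullet> b * m / s\<rfloor> \<in> {- int m..int m}" if "b \<in> J" for b
        proof -
          have "\<bar>(x - q) \<bullet> b\<bar> \<le> s" using x that by auto
          then have "\<bar>(x - q) \<bullet> b * m / s\<bar> \<le> m"
            using s m by (simp add: abs_mult field_simps mult_left_mono)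
          then have "- real m \<le> (x - q) \<bullet> b * m / s" "(x - q) \<bullet> b * m / s \<le> real m"
            by linarith+
          then show ?thesis by (auto simp: le_floor_iff floor_le_iff)
        qed
        then have "\<phi> \<in> \<Phi>" by (auto simp: \<phi>_def \<Phi>_def)
        moreover have "x \<in> cell \<phi>" using x by (auto simp: cell_def \<phi>_def)
        ultimately show "x \<in> \<Union> (cell ` \<Phi>)" by blast
      qed
      fix U assume "U \<in> cell ` \<Phi>"
      then have U: "dist x y \<le> DIM('a) * s / m" if "x \<in> U" "y \<in> U" for x y
        using diam that by blast
      show "bounded U" using U bounded_two_points by blast
      show "diameter U \<le> DIM('a) * s / m"
        using U s by (intro diameter_le) (auto simp: dist_norm)
    qed
  qed
  then show ?thesis by simp
qed

lemma hausdorff_outer_cball_le: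
  "\<exists>C\<ge>0. \<forall>(q::'a::euclidean_space) s. s > 0 \<longrightarrow>
     hausdorff_outer DIM('a) (cball q s) \<le> ennreal (C * s ^ DIM('a))"
proof (intro exI[of _ "3 ^ DIM('a) * (unit_ball_vol DIM('a) * (DIM('a) / 2) ^ DIM('a))"] conjI allI impI)
  fix q :: 'a and s :: real assume s: "s > 0"
  have "cball q s \<subseteq> {x. (\<forall>b\<in>Basis. \<bar>(x - q) \<bullet> b\<bar> \<le> s) \<and> (\<forall>b\<in>Basis - Basis. x \<bullet> b = 0)}"
    by (auto simp: dist_norm norm_minus_commute intro: norm_bound_Basis_le)
  then have "hausdorff_outer DIM('a) (cball q s) \<le> hausdorff_outer DIM('a) \<dots>"
    by (rule hausdorff_outer_mono)
  also have "\<dots> \<le> ennreal (3 ^ DIM('a) * (unit_ball_vol DIM('a) * (DIM('a) * s / 2) ^ DIM('a)))"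
    using hausdorff_outer_cube_le[OF order_refl[of "Basis :: 'a set"] s, where q = q and c = "\<lambda>_. 0"] by simp
  finally show "hausdorff_outer DIM('a) (cball q s)
      \<le> ennreal (3 ^ DIM('a) * (unit_ball_vol DIM('a) * (DIM('a) / 2) ^ DIM('a)) * s ^ DIM('a))"
    by (simp add: power_mult_distrib power_divide field_simps)
qed auto

lemma hausdorff_outer_image_nonexpansive:
  fixes g :: "'a::metric_space \<Rightarrow> 'b::metric_space"
  assumes g: "\<And>x y. dist (g x) (g y) \<le> dist x y"
  shows "hausdorff_outer k (g ` A) \<le> hausdorff_outer k A"
  unfolding hausdorff_outer_def
proof (intro SUP_mono bexI)
  fix \<delta> :: real
  show "hausdorff_pre k \<delta> (g ` A) \<le> hausdorff_pre k \<delta> A"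
    unfolding hausdorff_pre_def[of k \<delta> A]
  proof (rule INF_greatest, clarify)
    fix U :: "nat \<Rightarrow> 'a set"
    assume A: "A \<subseteq> (\<Union>i. U i)" and U: "\<forall>i. bounded (U i) \<and> diameter (U i) \<le> \<delta>"
    have dg: "dist (g x) (g y) \<le> diameter (U i)" if "x \<in> U i" "y \<in> U i" for x y i
      using g[of x y] diameter_bounded_bound[of "U i" x y] U that by fastforce
    have bd: "bounded (g ` U i)" for i
      unfolding bounded_two_points using dg by blast
    have dm: "diameter (g ` U i) \<le> diameter (U i)" for i
    proof (cases "U i = {}")
      case False
      then have "diameter (g ` U i) = (SUP (x,y) \<in> g ` U i \<times> g ` U i. dist x y)"
        by (simp add: diameter_def)
      also have "\<dots> \<le> diameter (U i)"
        using False dg by (intro cSUP_least) auto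
      finally show ?thesis .
    qed simp
    have "hausdorff_pre k \<delta> (g ` A) \<le> (\<Sum>i. hausdorff_weight k (g ` U i))"
      unfolding hausdorff_pre_def
    proof (intro INF_lower CollectI conjI allI)
      show "g ` A \<subseteq> (\<Union>i. g ` U i)" using A by blast
    qed (use bd dm U order_trans in blast)+
    also have "\<dots> \<le> (\<Sum>i. hausdorff_weight k (U i))"
      using dm bd unfolding hausdorff_weight_def
      by (intro suminf_le) (auto intro!: ennreal_leI mult_left_mono power_mono simp: diameter_ge_0)
    finally show "hausdorff_pre k \<delta> (g ` A) \<le> (\<Sum>i. hausdorff_weight k (U i))" .
  qed
qed

lemma hausdorff_outer_finite_UN:
  assumes "finite I" "\<And>i. i \<in> I \<Longrightarrow> hausdorff_outer k (A i) < \<infinity>"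
  shows "hausdorff_outer k (\<Union>i\<in>I. A i) < \<infinity>"
  using assms
proof (induction I)
  case (insert i I)
  have "hausdorff_outer k (\<Union>i\<in>insert i I. A i) \<le> hausdorff_outer k (A i) + hausdorff_outer k (\<Union>i\<in>I. A i)"
    using hausdorff_outer_Un_le[of k "A i" "\<Union>i\<in>I. A i"] by simp
  also have "\<dots> < \<infinity>" using insert by simp
  finally show ?case .
qed simp

lemma supporting_normal:
  fixes \<Omega> :: "'a::euclidean_space set"
  assumes "convex \<Omega>" "open \<Omega>" "p \<in> frontier \<Omega>"
  obtains e where "norm e = 1" "\<And>y. y \<in> closure \<Omega> \<Longrightarrow> 0 \<le> (y - p) \<bullet> e"
proof -
  have "p \<in> closure \<Omega>" "p \<notin> rel_interior \<Omega>"
    using assms by (auto simp: frontier_def rel_interior_open interior_open)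
  then obtain a where a: "a \<noteq> 0" "\<And>y. y \<in> closure \<Omega> \<Longrightarrow> a \<bullet> p \<le> a \<bullet> y"
    using supporting_hyperplane_relative_frontier[OF assms(1)] by metis
  show ?thesis
  proof (rule that[of "a /\<^sub>R norm a"])
    show "norm (a /\<^sub>R norm a) = 1" using a(1) by simp
    fix y assume "y \<in> closure \<Omega>"
    then have "0 \<le> a \<bullet> (y - p)" using a(2) by (simp add: inner_diff_right)
    then show "0 \<le> (y - p) \<bullet> (a /\<^sub>R norm a)" by (simp add: inner_commute)
  qed
qed

text \<open>
  The nearest-point projection onto a closed convex set is nonexpansive, and it maps the surface of a
  surrounding cube onto the frontier: from a frontier point \<open>p\<close> follow the outer normal \<open>- e\<close> until it
  meets the cube surface; every point on this ray projects back to \<open>p\<close>. The surface of the cube has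
  finite \<open>(n - 1)\<close>-dimensional measure by the grid bound, hence so does the frontier.

  Finiteness matters because the Bochner integral of a nonintegrable function is \<open>0\<close>: without it the
  boundary integral could vanish for a positive \<open>f\<close>.
\<close>

lemma hausdorff_outer_frontier_convex_finite:
  fixes \<Omega> :: "'a::euclidean_space set"
  assumes "convex \<Omega>" "open \<Omega>" "bounded \<Omega>"
  shows "hausdorff_outer (DIM('a) - 1) (frontier \<Omega>) < \<infinity>"
proof -
  obtain B where B: "\<And>x. x \<in> closure \<Omega> \<Longrightarrow> norm x \<le> B"
    using assms(3) bounded_closure bounded_iff by metis
  define s where "s = \<bar>B\<bar> + 1"
  have s: "s > 0" by (simp add: s_def)
  define face where "face = (\<lambda>(i, t). {x::'a. (\<forall>b\<in>Basis - {i}. \<bar>(x - 0) \<bullet> b\<bar> \<le> s) \<and>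
                                  (\<forall>b\<in>Basis - (Basis - {i}). x \<bullet> b = t)})"
  define Q where "Q = (\<Union>i\<in>Basis \<times> {s, - s}. face i)"
  have "hausdorff_outer (DIM('a) - 1) Q < \<infinity>"
    unfolding Q_def
  proof (rule hausdorff_outer_finite_UN)
    fix i :: "'a \<times> real" assume i: "i \<in> Basis \<times> {s, - s}"
    have "hausdorff_outer (card (Basis - {fst i})) (face i) < \<infinity>"
      unfolding face_def case_prod_unfold
      by (rule le_less_trans[OF hausdorff_outer_cube_le[OF _ s]]) auto
    then show "hausdorff_outer (DIM('a) - 1) (face i) < \<infinity>" using i by auto
  qed auto
  moreover have "frontier \<Omega> \<subseteq> closest_point (closure \<Omega>) ` Q"
  proof
    fix p assume p: "p \<in> frontier \<Omega>"
    then have pc: "p \<in> closure \<Omega>" by (simp add: frontier_def)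
    obtain e where e: "norm e = 1" and sup: "\<And>y. y \<in> closure \<Omega> \<Longrightarrow> 0 \<le> (y - p) \<bullet> e"
      using supporting_normal[OF assms(1,2) p] by blast
    \<comment> \<open>The cube is the ball of radius \<open>s\<close> in the maximum norm, so the exit time solves \<open>h t = s\<close>.\<close>
    define h where "h t = infnorm (p - t *\<^sub>R e)" for t
    have inf_e: "infnorm e > 0" using e by (auto simp: infnorm_pos_lt)
    have "h 0 \<le> s" using B[OF pc] infnorm_le_norm[of p] by (simp add: h_def s_def)
    moreover have "s \<le> h (2 * s / infnorm e)"
    proof -
      have "2 * s = infnorm ((2 * s / infnorm e) *\<^sub>R e)"
        using inf_e s by (simp add: infnorm_mul)
      also have "\<dots> \<le> infnorm p + h (2 * s / infnorm e)"
        unfolding h_def using infnorm_triangle[of p "- (p - (2 * s / infnorm e) *\<^sub>R e)"] by (simp only: infnorm_neg) simp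
      finally show ?thesis using \<open>h 0 \<le> s\<close> by (simp add: h_def)
    qed
    moreover have "continuous_on {0..2 * s / infnorm e} h"
      unfolding h_def by (intro continuous_intros)
    ultimately obtain t where t: "t \<ge> 0" "h t = s"
      using IVT'[of h 0 s "2 * s / infnorm e"] s inf_e by auto
    have "p - t *\<^sub>R e \<in> Q"
    proof -
      have M: "infnorm (p - t *\<^sub>R e) = Max ((\<lambda>i. \<bar>(p - t *\<^sub>R e) \<bullet> i\<bar>) ` Basis)" by (rule infnorm_Max)
      then have "s \<in> (\<lambda>i. \<bar>(p - t *\<^sub>R e) \<bullet> i\<bar>) ` Basis"
        using t(2) Max_in[of "(\<lambda>i. \<bar>(p - t *\<^sub>R e) \<bullet> i\<bar>) ` Basis"] by (simp add: h_def)
      then obtain i where i: "i \<in> Basis" "s = \<bar>(p - t *\<^sub>R e) \<bullet> i\<bar>" by blast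
      have le: "\<bar>(p - t *\<^sub>R e) \<bullet> b\<bar> \<le> s" if "b \<in> Basis" for b
        using Basis_le_infnorm[OF that, of "p - t *\<^sub>R e"] t(2) by (simp add: h_def)
      have it: "(p - t *\<^sub>R e) \<bullet> i \<in> {s, - s}" using i(2) by auto
      have "p - t *\<^sub>R e \<in> face (i, (p - t *\<^sub>R e) \<bullet> i)" using le i by (auto simp: face_def)
      then show ?thesis unfolding Q_def using i(1) it by (intro UN_I[of "(i, (p - t *\<^sub>R e) \<bullet> i)"]) auto
    qed
    moreover have "p = closest_point (closure \<Omega>) (p - t *\<^sub>R e)"
    proof (rule closest_point_unique)
      show "\<forall>z\<in>closure \<Omega>. dist (p - t *\<^sub>R e) p \<le> dist (p - t *\<^sub>R e) z"
      proof
        fix z assume z: "z \<in> closure \<Omega>"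
        have "(t *\<^sub>R e) \<bullet> (t *\<^sub>R e) \<le> (z - p) \<bullet> (z - p) + 2 * (t * ((z - p) \<bullet> e)) + (t *\<^sub>R e) \<bullet> (t *\<^sub>R e)"
          using sup[OF z] t(1) by simp
        also have "\<dots> = (z - p + t *\<^sub>R e) \<bullet> (z - p + t *\<^sub>R e)"
          by (simp add: inner_add_left inner_add_right inner_commute)
        finally have "norm (t *\<^sub>R e) \<le> norm (z - p + t *\<^sub>R e)" unfolding norm_le .
        then show "dist (p - t *\<^sub>R e) p \<le> dist (p - t *\<^sub>R e) z"
          by (simp add: dist_norm norm_minus_commute algebra_simps)
      qed
    qed (use assms pc in \<open>auto intro: convex_closure\<close>)
    ultimately show "p \<in> closest_point (closure \<Omega>) ` Q" by blast
  qed
  moreover have "hausdorff_outer (DIM('a) - 1) (closest_point (closure \<Omega>) ` Q)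
      \<le> hausdorff_outer (DIM('a) - 1) Q" if "\<Omega> \<noteq> {}"
    using that assms by (intro hausdorff_outer_image_nonexpansive closest_point_lipschitz) (auto intro: convex_closure)
  ultimately show ?thesis
    by (cases "\<Omega> = {}") (auto intro: le_less_trans[OF order_trans[OF hausdorff_outer_mono]])
qed

section \<open>Ball coverings and integrals against Hausdorff measure\<close>

text \<open>
  Hausdorff-optimal coverings become coverings by balls centred in the set: a covering set of diameter
  \<open>d\<close> that meets \<open>E\<close> lies in a ball of radius \<open>d + t\<close> about any of its points in \<open>E\<close>, where the positive
  \<open>t\<close> makes the ball open and leaves room for sets of diameter \<open>0\<close>. The price is the factor
  \<open>4 ^ k / unit_ball_vol k\<close>, of which \<open>2 ^ k\<close> comes from the radius \<open>d / 2\<close> in the Hausdorff weight and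
  \<open>2 ^ k\<close> from separating \<open>d\<close> and \<open>t\<close>, plus an arbitrarily small error for all the \<open>t\<close> together. As
  only finite subfamilies are used, the bound is stated for their sums.
\<close>

lemma exists_balls_of_hausdorff_sum:
  fixes E :: "'a::metric_space set"
  assumes k: "k > 0" and fin: "hausdorff_outer k E \<le> ennreal \<mu>" and \<mu>: "\<mu> \<ge> 0"
    and \<delta>: "\<delta> > 0" and \<tau>: "\<tau> > 0"
  shows "\<exists>S. S \<subseteq> E \<times> {0<..<\<delta>} \<and> E \<subseteq> (\<Union>(p, r)\<in>S. ball p r) \<and>
           (\<forall>F. finite F \<and> F \<subseteq> S \<longrightarrow> (\<Sum>(p, r)\<in>F. r ^ k) \<le> 4 ^ k / unit_ball_vol (real k) * \<mu> + \<tau>)"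
proof -
  define \<omega> where "\<omega> = unit_ball_vol (real k)"
  have \<omega>: "\<omega> > 0" by (simp add: \<omega>_def)
  define \<tau>' where "\<tau>' = \<omega> * \<tau> / (2 * 4 ^ k)"
  have \<tau>': "\<tau>' > 0" using \<omega> \<tau> by (simp add: \<tau>'_def)
  have "hausdorff_pre k (\<delta> / 2) E \<le> hausdorff_outer k E"
    using \<delta> by (intro hausdorff_pre_le_outer) auto
  also have "\<dots> < ennreal (\<mu> + \<tau>')"
    using fin \<mu> \<tau>' by (elim le_less_trans) (simp add: ennreal_less_iff)
  finally obtain U where cov: "E \<subseteq> (\<Union>i. U i)"
    and U: "\<And>i. bounded (U i) \<and> diameter (U i) \<le> \<delta> / 2"
    and sum: "(\<Sum>i. hausdorff_weight k (U i)) < ennreal (\<mu> + \<tau>')"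
    unfolding hausdorff_pre_def INF_less_iff by blast
  define d where "d i = diameter (U i)" for i
  have d: "0 \<le> d i" "d i \<le> \<delta> / 2" for i
    using U[of i] by (auto simp: d_def diameter_ge_0)
  \<comment> \<open>The enlargements are at most \<open>1\<close>, so that \<open>t i ^ k \<le> t i\<close>, and their sum is geometric.\<close>
  define t where "t i = min (\<delta> / 4) (min 1 (\<tau> / (2 * 2 ^ k)) * (1 / 2) ^ Suc i)" for i :: nat
  have t: "0 < t i" "t i \<le> \<delta> / 4" "t i \<le> 1" "t i \<le> \<tau> / (2 * 2 ^ k) * (1 / 2) ^ Suc i" for i
  proof -
    show "0 < t i" "t i \<le> \<delta> / 4" using \<delta> \<tau> by (auto simp: t_def)
    have "t i \<le> min 1 (\<tau> / (2 * 2 ^ k)) * (1 / 2) ^ Suc i"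
      unfolding t_def by (rule min.cobounded2)
    moreover have "min 1 (\<tau> / (2 * 2 ^ k)) * (1 / 2) ^ Suc i \<le> 1 * 1"
      using \<tau> by (intro mult_mono power_le_one) auto
    moreover have "min 1 (\<tau> / (2 * 2 ^ k)) * (1 / 2) ^ Suc i \<le> \<tau> / (2 * 2 ^ k) * (1 / 2) ^ Suc i"
      by (intro mult_right_mono) auto
    ultimately show "t i \<le> 1" "t i \<le> \<tau> / (2 * 2 ^ k) * (1 / 2) ^ Suc i" by linarith+
  qed
  define r where "r i = d i + t i" for i
  define I where "I = {i. U i \<inter> E \<noteq> {}}"
  define p where "p i = (SOME x. x \<in> U i \<inter> E)" for i
  have p: "p i \<in> U i" "p i \<in> E" if "i \<in> I" for i
    using that someI_ex[of "\<lambda>x. x \<in> U i \<inter> E"] by (auto simp: I_def p_def)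
  have r: "0 < r i" "r i < \<delta>" for i
    using d[of i] t[of i] \<delta> by (auto simp: r_def)
  have rk: "r i ^ k \<le> 2 ^ k * d i ^ k + 2 ^ k * t i" for i
  proof -
    have "r i ^ k \<le> (2 * max (d i) (t i)) ^ k"
      using d(1)[of i] t(1)[of i] by (intro power_mono) (auto simp: r_def)
    also have "\<dots> = 2 ^ k * max (d i) (t i) ^ k" by (simp add: power_mult_distrib)
    also have "max (d i) (t i) ^ k \<le> d i ^ k + t i ^ k"
      using d(1)[of i] t(1)[of i] by (auto simp: max_def)
    also have "t i ^ k \<le> t i"
      using t(1,3)[of i] k power_decreasing[of 1 k "t i"] by simp
    finally show ?thesis by (simp add: algebra_simps)
  qed
  have dw: "ennreal (\<omega> / 2 ^ k * d i ^ k) = hausdorff_weight k (U i)" if "i \<in> I" for i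
    using that by (auto simp: I_def hausdorff_weight_def d_def \<omega>_def power_divide)
  have sumF: "(\<Sum>i\<in>F. r i ^ k) \<le> 4 ^ k / \<omega> * \<mu> + \<tau>" if F: "finite F" "F \<subseteq> I" for F
  proof -
    have "ennreal (\<Sum>i\<in>F. \<omega> / 2 ^ k * d i ^ k) = (\<Sum>i\<in>F. hausdorff_weight k (U i))"
    proof -
      have "(\<Sum>i\<in>F. hausdorff_weight k (U i)) = (\<Sum>i\<in>F. ennreal (\<omega> / 2 ^ k * d i ^ k))"
        using F dw by (intro sum.cong) auto
      also have "\<dots> = ennreal (\<Sum>i\<in>F. \<omega> / 2 ^ k * d i ^ k)"
        using d(1) \<omega> by (intro sum_ennreal) simp
      finally show ?thesis ..
    qed
    also have "\<dots> \<le> (\<Sum>i. hausdorff_weight k (U i))"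
      using F by (intro sum_le_suminf) auto
    also have "\<dots> \<le> ennreal (\<mu> + \<tau>')" using sum by simp
    finally have "(\<Sum>i\<in>F. \<omega> / 2 ^ k * d i ^ k) \<le> \<mu> + \<tau>'"
      using \<mu> \<tau>' by (subst (asm) ennreal_le_iff) auto
    then have "\<omega> / 2 ^ k * (\<Sum>i\<in>F. d i ^ k) \<le> \<mu> + \<tau>'"
      by (simp add: sum_distrib_left)
    then have "4 ^ k / \<omega> * (\<omega> / 2 ^ k * (\<Sum>i\<in>F. d i ^ k)) \<le> 4 ^ k / \<omega> * (\<mu> + \<tau>')"
      using \<omega> by (intro mult_left_mono) auto
    moreover have "4 ^ k / \<omega> * (\<omega> / 2 ^ k * (\<Sum>i\<in>F. d i ^ k)) = 2 ^ k * (\<Sum>i\<in>F. d i ^ k)"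
    proof -
      have "(4::real) ^ k = 2 ^ k * 2 ^ k" by (simp flip: power_mult_distrib)
      then show ?thesis using \<omega> by simp
    qed
    moreover have "4 ^ k / \<omega> * \<tau>' = \<tau> / 2"
      using \<omega> by (simp add: \<tau>'_def)
    ultimately have D: "2 ^ k * (\<Sum>i\<in>F. d i ^ k) \<le> 4 ^ k / \<omega> * \<mu> + \<tau> / 2"
      unfolding distrib_left by linarith
    have "(\<Sum>i\<in>F. (1 / 2 :: real) ^ Suc i) \<le> (\<Sum>i. (1 / 2) ^ Suc i)"
      using F power_half_series by (intro sum_le_suminf) (auto simp: sums_iff)
    also have "\<dots> = 1" using power_half_series by (simp add: sums_iff)
    finally have G: "(\<Sum>i\<in>F. (1 / 2 :: real) ^ Suc i) \<le> 1" .
    have "(\<Sum>i\<in>F. t i) \<le> (\<Sum>i\<in>F. \<tau> / (2 * 2 ^ k) * (1 / 2) ^ Suc i)"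
      using t(4) by (intro sum_mono)
    also have "\<dots> = \<tau> / (2 * 2 ^ k) * (\<Sum>i\<in>F. (1 / 2) ^ Suc i)"
      by (simp add: sum_distrib_left)
    also have "\<dots> \<le> \<tau> / (2 * 2 ^ k)"
      using mult_left_mono[OF G, of "\<tau> / (2 * 2 ^ k)"] \<tau> by simp
    finally have T: "2 ^ k * (\<Sum>i\<in>F. t i) \<le> \<tau> / 2" by (simp add: field_simps)
    have "(\<Sum>i\<in>F. r i ^ k) \<le> (\<Sum>i\<in>F. 2 ^ k * d i ^ k + 2 ^ k * t i)"
      by (intro sum_mono rk)
    also have "\<dots> = 2 ^ k * (\<Sum>i\<in>F. d i ^ k) + 2 ^ k * (\<Sum>i\<in>F. t i)"
      by (simp add: sum.distrib sum_distrib_left)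
    finally show ?thesis using D T by simp
  qed
  show ?thesis
  proof (intro exI[of _ "(\<lambda>i. (p i, r i)) ` I"] conjI allI impI)
    show "(\<lambda>i. (p i, r i)) ` I \<subseteq> E \<times> {0<..<\<delta>}" using p r by auto
    show "E \<subseteq> (\<Union>(p, r)\<in>(\<lambda>i. (p i, r i)) ` I. ball p r)"
    proof
      fix x assume x: "x \<in> E"
      then obtain i where i: "x \<in> U i" using cov by blast
      then have "i \<in> I" using x by (auto simp: I_def)
      moreover have "dist (p i) x < r i"
        using diameter_bounded_bound[of "U i" "p i" x] U[of i] p(1)[OF \<open>i \<in> I\<close>] i t(1)[of i]
        by (simp add: r_def d_def)
      ultimately show "x \<in> (\<Union>(p, r)\<in>(\<lambda>i. (p i, r i)) ` I. ball p r)" by auto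
    qed
    fix F assume F: "finite F \<and> F \<subseteq> (\<lambda>i. (p i, r i)) ` I"
    then obtain F' where F': "F' \<subseteq> I" "finite F'" "F = (\<lambda>i. (p i, r i)) ` F'"
      by (meson finite_subset_image)
    have "(\<Sum>(p, r)\<in>F. r ^ k) \<le> (\<Sum>i\<in>F'. r i ^ k)"
      using sum_image_le[OF F'(2), of "\<lambda>(p, r). r ^ k" "\<lambda>i. (p i, r i)"] r(1) unfolding F'(3)
      by (auto simp: less_imp_le)
    also have "\<dots> \<le> 4 ^ k / \<omega> * \<mu> + \<tau>" by (rule sumF[OF F'(2,1)])
    finally show "(\<Sum>(p, r)\<in>F. r ^ k) \<le> 4 ^ k / unit_ball_vol (real k) * \<mu> + \<tau>"
      by (simp add: \<omega>_def)
  qed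
qed

lemma set_integrable_hausdorff_measure:
  fixes f :: "'a::metric_space \<Rightarrow> real"
  assumes A: "A \<in> sets borel" and cont: "continuous_on A f" and B: "\<And>x. x \<in> A \<Longrightarrow> \<bar>f x\<bar> \<le> B"
    and fin: "emeasure (hausdorff_measure k) A < \<infinity>"
  shows "set_integrable (hausdorff_measure k) A f"
  unfolding set_integrable_def
proof (rule integrableI_bounded_set[where A = A and B = B])
  show "(\<lambda>x. indicator A x *\<^sub>R f x) \<in> borel_measurable (hausdorff_measure k)"
    using borel_measurable_continuous_on_indicator[OF A cont]
    by (simp cong: measurable_cong_sets)
qed (use assms in auto)

text \<open>
  This lemma is the bridge from coverings to the boundary integral: a compact set is covered by small
  balls in such a way that the sums of \<open>f p * r ^ k\<close> are controlled by the integral of \<open>f\<close>. For a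
  constant \<open>f\<close> this is, up to a factor, the definition of Hausdorff measure; a continuous \<open>f\<close> is nearly constant
  on each of the sets \<open>E j\<close> on which \<open>f\<close> lies between \<open>\<eta> * j\<close> and \<open>\<eta> * (j + 1)\<close>, and these sets are
  covered separately. Compactness then reduces the cover to a finite one.
\<close>

lemma exists_ball_cover_sum_le_integral:
  fixes K :: "'a::metric_space set" and f :: "'a \<Rightarrow> real"
  assumes k: "k > 0" and K: "compact K" and fin: "hausdorff_outer k K < \<infinity>"
    and cont: "continuous_on K f" and nonneg: "\<And>x. x \<in> K \<Longrightarrow> 0 \<le> f x"
    and \<delta>: "\<delta> > 0" and \<epsilon>: "\<epsilon> > 0"
  shows "\<exists>F. finite F \<and> F \<subseteq> K \<times> {0<..<\<delta>} \<and> K \<subseteq> (\<Union>(p, r)\<in>F. ball p r) \<and>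
           (\<Sum>(p, r)\<in>F. f p * r ^ k)
             \<le> 4 ^ k / unit_ball_vol (real k) * (LINT x:K|hausdorff_measure k. f x) + \<epsilon>"
proof -
  let ?M = "hausdorff_measure k :: 'a measure"
  define C where "C = 4 ^ k / unit_ball_vol (real k)"
  have C: "C > 0" by (simp add: C_def)
  have Kb: "K \<in> sets borel" using K by (simp add: borel_compact)
  have emK: "emeasure ?M K < \<infinity>" using fin Kb by (simp add: emeasure_hausdorff_measure)
  obtain B where B: "\<And>x. x \<in> K \<Longrightarrow> \<bar>f x\<bar> \<le> B"
    using compact_imp_bounded[OF compact_continuous_image[OF cont K]] by (auto simp: bounded_iff)
  define \<eta> where "\<eta> = \<epsilon> / (2 * (C * measure ?M K + 1))"
  have \<eta>: "\<eta> > 0" using \<epsilon> C by (simp add: \<eta>_def add_nonneg_pos)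
  have \<eta>C: "C * (\<eta> * measure ?M K) \<le> \<epsilon> / 2"
  proof -
    have "C * (\<eta> * measure ?M K) \<le> \<eta> * (C * measure ?M K + 1)" using \<eta> by (simp add: algebra_simps)
    also have "\<dots> = \<epsilon> / 2" using C add_nonneg_pos[of "C * measure ?M K" 1] by (simp add: \<eta>_def field_simps)
    finally show ?thesis .
  qed
  obtain J0 :: nat where J0: "B / \<eta> < real J0" using reals_Archimedean2 by blast
  define J where "J = Suc J0"
  define lev where "lev x = nat \<lfloor>f x / \<eta>\<rfloor>" for x
  define E where "E j = {x\<in>K. lev x = j}" for j
  have lev: "\<eta> * lev x \<le> f x" "f x \<le> \<eta> * Suc (lev x)" "lev x < J" if "x \<in> K" for x
  proof -
    have nn: "0 \<le> f x / \<eta>" using nonneg[OF that] \<eta> by simp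
    then have lx: "real (lev x) = of_int \<lfloor>f x / \<eta>\<rfloor>" by (simp add: lev_def)
    have 1: "real (lev x) \<le> f x / \<eta>" "f x / \<eta> < real (lev x) + 1" unfolding lx by linarith+
    then show "\<eta> * lev x \<le> f x" "f x \<le> \<eta> * Suc (lev x)" using \<eta> by (auto simp: field_simps)
    have "f x / \<eta> \<le> B / \<eta>" using B[OF that] \<eta> by (simp add: divide_right_mono)
    then show "lev x < J" using 1 J0 by (simp add: J_def)
  qed
  have EB: "E j \<in> sets borel" for j
  proof -
    define a where "a = (\<lambda>x. indicator K x *\<^sub>R f x)"
    have [measurable]: "a \<in> borel_measurable borel" "K \<in> sets borel"
      unfolding a_def using borel_measurable_continuous_on_indicator[OF Kb cont] Kb by auto
    have "E j = K \<inter> {x. nat \<lfloor>a x / \<eta>\<rfloor> = j}"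
      by (auto simp: E_def lev_def a_def)
    also have "\<dots> \<in> sets borel" by measurable
    finally show ?thesis .
  qed
  define \<mu> where "\<mu> j = measure ?M (E j)" for j
  have EK: "E j \<subseteq> K" for j by (auto simp: E_def)
  have emE: "emeasure ?M (E j) < \<infinity>" for j
    using emK emeasure_mono[of "E j" K ?M] EK Kb by (auto intro: le_less_trans)
  have outE: "hausdorff_outer k (E j) \<le> ennreal (\<mu> j)" for j
    using emE[of j] EB by (simp add: \<mu>_def emeasure_hausdorff_measure[symmetric] emeasure_eq_ennreal_measure)
  define \<tau> where "\<tau> = \<epsilon> / (2 * ((\<Sum>j<J. \<eta> * Suc j) + 1))"
  have sumpos: "(\<Sum>j<J. \<eta> * Suc j) \<ge> 0" using \<eta> by (intro sum_nonneg) auto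
  have \<tau>: "\<tau> > 0" using \<epsilon> sumpos by (simp add: \<tau>_def)
  have \<tau>sum: "(\<Sum>j<J. \<eta> * Suc j) * \<tau> \<le> \<epsilon> / 2"
  proof -
    have "(\<Sum>j<J. \<eta> * Suc j) * \<tau> \<le> ((\<Sum>j<J. \<eta> * Suc j) + 1) * \<tau>" using \<tau> by (simp add: algebra_simps)
    also have "\<dots> = \<epsilon> / 2" using sumpos add_nonneg_pos[OF sumpos, of 1] unfolding \<tau>_def by (simp add: divide_simps)
    finally show ?thesis .
  qed
  have "\<exists>S. S \<subseteq> E j \<times> {0<..<\<delta>} \<and> E j \<subseteq> (\<Union>(p, r)\<in>S. ball p r) \<and>
      (\<forall>F. finite F \<and> F \<subseteq> S \<longrightarrow> (\<Sum>(p, r)\<in>F. r ^ k) \<le> C * \<mu> j + \<tau>)" for j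
    unfolding C_def
    by (rule exists_balls_of_hausdorff_sum[OF k outE _ \<delta> \<tau>]) (simp add: \<mu>_def)
  then obtain S where S: "\<And>j. S j \<subseteq> E j \<times> {0<..<\<delta>}" "\<And>j. E j \<subseteq> (\<Union>(p, r)\<in>S j. ball p r)"
    "\<And>j F. finite F \<Longrightarrow> F \<subseteq> S j \<Longrightarrow> (\<Sum>(p, r)\<in>F. r ^ k) \<le> C * \<mu> j + \<tau>"
    by metis
  have "K \<subseteq> (\<Union>s\<in>(\<Union>j<J. S j). ball (fst s) (snd s))"
  proof
    fix x assume x: "x \<in> K"
    then have "x \<in> E (lev x)" by (simp add: E_def)
    then obtain s where "s \<in> S (lev x)" "x \<in> ball (fst s) (snd s)" using S(2) by fastforce
    then show "x \<in> (\<Union>s\<in>(\<Union>j<J. S j). ball (fst s) (snd s))" using lev(3)[OF x] by blast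
  qed
  then obtain F where F: "F \<subseteq> (\<Union>j<J. S j)" "finite F" "K \<subseteq> (\<Union>s\<in>F. ball (fst s) (snd s))"
    by (rule compactE_image[OF K, rotated]) auto
  have FK: "F \<subseteq> K \<times> {0<..<\<delta>}"
  proof
    fix s assume "s \<in> F"
    then obtain j where "s \<in> S j" using F(1) by blast
    then show "s \<in> K \<times> {0<..<\<delta>}" using S(1) EK by fastforce
  qed
  have "(\<Sum>(p, r)\<in>F. f p * r ^ k) \<le> C * (LINT x:K|?M. f x) + \<epsilon>"
  proof -
    have "(\<Sum>(p, r)\<in>F. f p * r ^ k) = (\<Sum>j<J. \<Sum>(p, r)\<in>{s\<in>F. lev (fst s) = j}. f p * r ^ k)"
      using FK lev(3) F(2) by (subst sum.group) auto
    also have "\<dots> \<le> (\<Sum>j<J. \<eta> * Suc j * (C * \<mu> j + \<tau>))"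
    proof (intro sum_mono)
      fix j
      have sub: "{s\<in>F. lev (fst s) = j} \<subseteq> S j"
      proof
        fix s assume s: "s \<in> {s\<in>F. lev (fst s) = j}"
        then obtain i where i: "s \<in> S i" using F(1) by blast
        then have "fst s \<in> E i" using S(1) by fastforce
        then have "i = j" using s by (simp add: E_def)
        then show "s \<in> S j" using i by simp
      qed
      have "(\<Sum>(p, r)\<in>{s\<in>F. lev (fst s) = j}. f p * r ^ k)
          \<le> (\<Sum>(p, r)\<in>{s\<in>F. lev (fst s) = j}. \<eta> * Suc j * r ^ k)"
      proof (rule sum_mono)
        fix s assume s: "s \<in> {s\<in>F. lev (fst s) = j}"
        then have "fst s \<in> K" "0 < snd s" "lev (fst s) = j" using FK by auto
        then have "f (fst s) * snd s ^ k \<le> \<eta> * Suc j * snd s ^ k"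
          using lev(2) by (auto intro!: mult_right_mono)
        then show "(case s of (p, r) \<Rightarrow> f p * r ^ k) \<le> (case s of (p, r) \<Rightarrow> \<eta> * Suc j * r ^ k)"
          by (simp add: case_prod_unfold)
      qed
      also have "\<dots> = \<eta> * Suc j * (\<Sum>(p, r)\<in>{s\<in>F. lev (fst s) = j}. r ^ k)"
        by (simp add: sum_distrib_left case_prod_unfold)
      also have "\<dots> \<le> \<eta> * Suc j * (C * \<mu> j + \<tau>)"
        using S(3)[OF _ sub] F(2) \<eta> by (intro mult_left_mono) auto
      finally show "(\<Sum>(p, r)\<in>{s\<in>F. lev (fst s) = j}. f p * r ^ k) \<le> \<eta> * Suc j * (C * \<mu> j + \<tau>)" .
    qed
    also have "\<dots> = C * (\<Sum>j<J. \<eta> * Suc j * \<mu> j) + (\<Sum>j<J. \<eta> * Suc j) * \<tau>"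
      by (simp add: algebra_simps sum.distrib sum_distrib_left sum_distrib_right)
    also have "(\<Sum>j<J. \<eta> * Suc j * \<mu> j) \<le> (LINT x:K|?M. f x) + \<eta> * measure ?M K"
    proof -
      have intE: "integrable ?M (\<lambda>x. (\<eta> * Suc j) * indicator (E j) x)" for j
        using EB emE by (intro integrable_mult_right integrable_real_indicator) auto
      have intf: "integrable ?M (\<lambda>x. indicator K x *\<^sub>R f x)"
        using set_integrable_hausdorff_measure[OF Kb cont B emK] by (simp add: set_integrable_def)
      have intK: "integrable ?M (\<lambda>x. \<eta> * indicator K x)"
        using Kb emK by (intro integrable_mult_right integrable_real_indicator) auto
      have "(\<Sum>j<J. \<eta> * Suc j * \<mu> j) = (\<Sum>j<J. (LINT x|?M. (\<eta> * Suc j) * indicator (E j) x))"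
        using EB by (simp add: \<mu>_def)
      also have "\<dots> = (LINT x|?M. (\<Sum>j<J. (\<eta> * Suc j) * indicator (E j) x))"
        using intE by (intro Bochner_Integration.integral_sum[symmetric])
      also have "\<dots> \<le> (LINT x|?M. indicator K x *\<^sub>R f x + \<eta> * indicator K x)"
      proof (rule integral_mono)
        fix x
        show "(\<Sum>j<J. \<eta> * Suc j * indicator (E j) x) \<le> indicator K x *\<^sub>R f x + \<eta> * indicator K x"
        proof (cases "x \<in> K")
          case True
          have "(\<Sum>j<J. \<eta> * Suc j * indicator (E j) x) = (\<Sum>j<J. if j = lev x then \<eta> * Suc j else 0)"
            using True by (intro sum.cong) (auto simp: E_def)
          also have "\<dots> = \<eta> * Suc (lev x)" using lev(3)[OF True] by simp
          also have "\<dots> \<le> f x + \<eta>" using lev(1)[OF True] by (simp add: algebra_simps)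
          finally show ?thesis using True by simp
        qed (simp add: E_def)
        show "integrable ?M (\<lambda>x. \<Sum>j<J. \<eta> * Suc j * indicator (E j) x)"
          by (intro Bochner_Integration.integrable_sum intE)
        show "integrable ?M (\<lambda>x. indicator K x *\<^sub>R f x + \<eta> * indicator K x)"
          by (intro Bochner_Integration.integrable_add intf intK)
      qed
      also have "\<dots> = (LINT x:K|?M. f x) + \<eta> * measure ?M K"
        using intf intK Kb by (simp add: set_lebesgue_integral_def)
      finally show ?thesis .
    qed
    finally show ?thesis using \<tau>sum \<eta>C C by (simp add: distrib_left)
  qed
  then show ?thesis using F FK by (intro exI[of _ F]) (auto simp: C_def case_prod_unfold)
qed

section \<open>Integrating a negative power of the distance\<close>

lemma exists_dyadic_scale:
  fixes d R :: real
  assumes "0 < d" "d < R"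
  shows "\<exists>j::nat. R / 2 ^ Suc j \<le> d \<and> d < R / 2 ^ j"
proof -
  have "\<exists>j::nat. R / 2 ^ j \<le> d"
  proof -
    obtain j :: nat where "R / d < 2 ^ j" using real_arch_pow[of 2 "R / d"] by auto
    then show ?thesis using assms by (intro exI[of _ j]) (simp add: field_simps)
  qed
  then obtain j where j: "R / 2 ^ j \<le> d" "\<And>i. i < j \<Longrightarrow> \<not> R / 2 ^ i \<le> d"
    unfolding exists_least_iff[of "\<lambda>j. R / 2 ^ j \<le> d"] by blast
  with assms obtain i where "j = Suc i" by (cases j) auto
  moreover from this j(2)[of i] have "d < R / 2 ^ i" by simp
  ultimately show ?thesis using j(1) by auto
qed

text \<open>
  For Lebesgue measure, a ball about the pole maximises the integral of \<open>1 / dist x q ^ (n - 1)\<close> among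
  all sets of the same volume. Up to constants, the growth bound for balls about \<open>q\<close> replaces the
  rearrangement. Beyond the radius \<open>R\<close> the integrand is at most \<open>1 / R ^ (n - 1)\<close>, so the contribution
  is at most \<open>R\<close>; inside, the shell at distance about \<open>2 ^ (- j) * R\<close>
  contributes at most a constant times \<open>2 ^ (- j) * R\<close>, and these contributions form a geometric
  series. With \<open>R ^ n\<close> equal to the volume, this produces the factor (volume) to the power \<open>1 / n\<close>.
\<close>

lemma nn_integral_dist_power_le:
  fixes M :: "'a::metric_space measure" and q :: 'a
  assumes sM: "sets M = sets borel" and A: "A \<in> sets borel" and q: "q \<notin> A" and n: "n > 0"
    and R: "R > 0" and MA: "emeasure M A \<le> ennreal (R ^ n)"
    and C: "C \<ge> 0" and ball: "\<And>s. s > 0 \<Longrightarrow> emeasure M (cball q s) \<le> ennreal (C * s ^ n)"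
  shows "(\<integral>\<^sup>+x\<in>A. ennreal (1 / dist x q ^ (n - 1)) \<partial>M) \<le> ennreal ((1 + 2 ^ n * C) * R)"
proof -
  have sp: "space M = UNIV" using sets_eq_imp_space_eq[OF sM] by simp
  have [measurable]: "A \<in> sets M" "\<And>s. cball q s \<in> sets M" using A sM by auto
  define w where "w j = (2 ^ Suc j / R) ^ (n - 1)" for j :: nat
  have w: "w j \<ge> 0" for j using R by (simp add: w_def)
  have pt: "ennreal (1 / dist x q ^ (n - 1)) * indicator A x
      \<le> ennreal (1 / R ^ (n - 1)) * indicator A x + (\<Sum>j. ennreal (w j) * indicator (cball q (R / 2 ^ j)) x)" for x
  proof (cases "x \<in> A \<and> dist x q < R")
    case True
    then have d: "0 < dist x q" using q by auto
    obtain j where j: "R / 2 ^ Suc j \<le> dist x q" "dist x q < R / 2 ^ j"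
      using exists_dyadic_scale[OF d] True by blast
    have "1 / dist x q \<le> 2 ^ Suc j / R" using j(1) d R by (simp add: field_simps)
    then have "1 / dist x q ^ (n - 1) \<le> w j"
      unfolding w_def using d by (subst power_one_over[symmetric], intro power_mono) auto
    then have "ennreal (1 / dist x q ^ (n - 1)) * indicator A x \<le> ennreal (w j) * indicator (cball q (R / 2 ^ j)) x"
      using j(2) True by (auto simp: dist_commute intro: ennreal_leI)
    also have "\<dots> \<le> (\<Sum>j. ennreal (w j) * indicator (cball q (R / 2 ^ j)) x)"
    proof -
      have "u j \<le> suminf u" for u :: "nat \<Rightarrow> ennreal" using sum_le_suminf[of u "{j}"] by simp
      then show ?thesis .
    qed
    finally show ?thesis by (rule add_increasing[rotated]) simp
  next
    case False
    then have "ennreal (1 / dist x q ^ (n - 1)) * indicator A x \<le> ennreal (1 / R ^ (n - 1)) * indicator A x"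
      using R by (cases "x \<in> A") (auto intro!: ennreal_leI divide_left_mono power_mono mult_pos_pos zero_less_power)
    then show ?thesis by (rule add_increasing2[rotated]) simp
  qed
  have Rn: "R ^ n = R * R ^ (n - 1)" using n by (cases n) auto
  have "(\<integral>\<^sup>+x\<in>A. ennreal (1 / dist x q ^ (n - 1)) \<partial>M)
      \<le> (\<integral>\<^sup>+x. ennreal (1 / R ^ (n - 1)) * indicator A x + (\<Sum>j. ennreal (w j) * indicator (cball q (R / 2 ^ j)) x) \<partial>M)"
    by (intro nn_integral_mono pt)
  also have "\<dots> = ennreal (1 / R ^ (n - 1)) * emeasure M A + (\<Sum>j. ennreal (w j) * emeasure M (cball q (R / 2 ^ j)))"
    by (subst nn_integral_add) (auto simp: nn_integral_suminf nn_integral_cmult_indicator)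
  also have "\<dots> \<le> ennreal R + (\<Sum>j. ennreal (2 ^ n * C * R * (1 / 2) ^ Suc j))"
  proof (intro add_mono suminf_le)
    have "ennreal (1 / R ^ (n - 1)) * emeasure M A \<le> ennreal (1 / R ^ (n - 1)) * ennreal (R ^ n)"
      by (intro mult_left_mono MA) simp
    also have "\<dots> = ennreal R" using R by (simp add: Rn flip: ennreal_mult)
    finally show "ennreal (1 / R ^ (n - 1)) * emeasure M A \<le> ennreal R" .
    fix j
    have "ennreal (w j) * emeasure M (cball q (R / 2 ^ j)) \<le> ennreal (w j) * ennreal (C * (R / 2 ^ j) ^ n)"
      using R by (intro mult_left_mono ball) auto
    also have "\<dots> = ennreal (w j * (C * (R / 2 ^ j) ^ n))"
      using w C R by (simp add: ennreal_mult)
    also have "w j * (C * (R / 2 ^ j) ^ n) = 2 ^ n * C * R * (1 / 2) ^ Suc j"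
    proof -
      obtain k where k: "n = Suc k" using n by (cases n) auto
      have "w j * (C * (R / 2 ^ j) ^ n) = C * (R / 2 ^ j) * ((2 ^ Suc j / R) * (R / 2 ^ j)) ^ k"
        by (simp only: w_def k power_mult_distrib) simp
      also have "(2 ^ Suc j / R) * (R / 2 ^ j) = 2" using R by simp
      finally show ?thesis by (simp add: k power_one_over)
    qed
    finally show "ennreal (w j) * emeasure M (cball q (R / 2 ^ j)) \<le> ennreal (2 ^ n * C * R * (1 / 2) ^ Suc j)" .
  qed auto
  also have "(\<Sum>j. ennreal (2 ^ n * C * R * (1 / 2) ^ Suc j)) = ennreal (2 ^ n * C * R)"
    using sums_mult[OF power_half_series, of "2 ^ n * C * R"] C R
    by (intro suminf_ennreal_eq) auto
  also have "ennreal R + ennreal (2 ^ n * C * R) = ennreal ((1 + 2 ^ n * C) * R)"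
    using R C by (simp add: algebra_simps flip: ennreal_plus)
  finally show ?thesis .
qed

section \<open>The maximum principle\<close>

lemma DERIV_second_le_0_at_local_max:
  fixes g g' :: "real \<Rightarrow> real"
  assumes d: "d > 0" and g: "\<And>t. \<bar>t\<bar> < d \<Longrightarrow> (g has_real_derivative g' t) (at t)"
    and g': "(g' has_real_derivative l) (at 0)"
    and max: "\<And>t. \<bar>t\<bar> < d \<Longrightarrow> g t \<le> g 0"
  shows "l \<le> 0"
proof (rule ccontr)
  assume "\<not> l \<le> 0"
  have "g' 0 = 0" using d max by (intro DERIV_local_max[OF g[of 0], of d]) auto
  moreover obtain e where e: "e > 0" "\<And>h. 0 < h \<Longrightarrow> h < e \<Longrightarrow> g' 0 < g' (0 + h)"
    using DERIV_pos_inc_right[OF g'] \<open>\<not> l \<le> 0\<close> by (auto simp: not_le)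
  ultimately have pos: "0 < g' h" if "0 < h" "h < e" for h using that by fastforce
  define h where "h = min d e / 2"
  have h: "0 < h" "h < d" "h < e" using d e(1) by (auto simp: h_def)
  have "g 0 < g h"
  proof (rule DERIV_pos_imp_increasing_open[OF h(1)])
    show "\<exists>y. (g has_real_derivative y) (at x) \<and> 0 < y" if "0 < x" "x < h" for x
      using g[of x] pos[of x] that h by auto
    show "continuous_on {0..h} g"
      using g h by (intro DERIV_atLeastAtMost_imp_continuous_on) (metis abs_of_nonneg le_less_trans)
  qed
  then show False using max[of h] h by simp
qed

text \<open>
  The classical argument: after adding \<open>\<epsilon> * (y \<bullet> y)\<close> the Laplacian is strictly positive, so a maximum
  over the closure cannot be interior, where all pure second derivatives would be nonpositive.

  Only derivatives along the coordinate directions occur, given as functions \<open>D1\<close> and \<open>D2\<close>. In this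
  form the lemma applies to a difference of functions as soon as the derivatives of each are known.
\<close>

lemma subharmonic_le_0_of_frontier_le_0:
  fixes \<Omega> :: "'a::euclidean_space set" and g :: "'a \<Rightarrow> real" and D1 D2 :: "'a \<Rightarrow> 'a \<Rightarrow> real"
  assumes "open \<Omega>" "bounded \<Omega>" and cont: "continuous_on (closure \<Omega>) g"
    and D1: "\<And>b x. b \<in> Basis \<Longrightarrow> x \<in> \<Omega> \<Longrightarrow> ((\<lambda>t. g (x + t *\<^sub>R b)) has_real_derivative D1 b x) (at 0)"
    and D2: "\<And>b x. b \<in> Basis \<Longrightarrow> x \<in> \<Omega> \<Longrightarrow> ((\<lambda>t. D1 b (x + t *\<^sub>R b)) has_real_derivative D2 b x) (at 0)"
    and sub: "\<And>x. x \<in> \<Omega> \<Longrightarrow> 0 \<le> (\<Sum>b\<in>Basis. D2 b x)"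
    and bdry: "\<And>x. x \<in> frontier \<Omega> \<Longrightarrow> g x \<le> 0" and x: "x \<in> \<Omega>"
  shows "g x \<le> 0"
proof -
  obtain B where B: "\<And>y. y \<in> closure \<Omega> \<Longrightarrow> norm y \<le> B"
    using assms(2) bounded_closure bounded_iff by metis
  have bound: "g x \<le> \<epsilon> * B\<^sup>2" if \<epsilon>: "\<epsilon> > 0" for \<epsilon>
  proof -
    define G where "G y = g y + \<epsilon> * (y \<bullet> y)" for y
    have "continuous_on (closure \<Omega>) G"
      unfolding G_def by (intro continuous_intros cont)
    moreover have "compact (closure \<Omega>)" "closure \<Omega> \<noteq> {}"
      using assms(2) x closure_subset by (auto simp: compact_closure)
    ultimately obtain z where z: "z \<in> closure \<Omega>" "\<And>y. y \<in> closure \<Omega> \<Longrightarrow> G y \<le> G z"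
      using continuous_attains_sup[of "closure \<Omega>" G] by blast
    have "z \<notin> \<Omega>"
    proof
      assume z\<Omega>: "z \<in> \<Omega>"
      obtain d where d: "d > 0" "ball z d \<subseteq> \<Omega>" using openE[OF assms(1) z\<Omega>] by blast
      have line: "z + t *\<^sub>R b \<in> \<Omega>" if "b \<in> Basis" "\<bar>t\<bar> < d" for b t
        using that d(2) by (auto simp: subset_iff dist_norm)
      have "D2 b z + 2 * \<epsilon> \<le> 0" if b: "b \<in> Basis" for b
      proof (rule DERIV_second_le_0_at_local_max[OF d(1)])
        show "G (z + t *\<^sub>R b) \<le> G (z + 0 *\<^sub>R b)" if "\<bar>t\<bar> < d" for t
          using z(2) line[OF b that] closure_subset by auto
        show "((\<lambda>t. G (z + t *\<^sub>R b)) has_real_derivative D1 b (z + t *\<^sub>R b) + \<epsilon> * (2 * (z \<bullet> b) + 2 * t)) (at t)"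
          if "\<bar>t\<bar> < d" for t
        proof -
          have "((\<lambda>u. g ((z + t *\<^sub>R b) + (u - t) *\<^sub>R b)) has_real_derivative D1 b (z + t *\<^sub>R b)) (at t)"
            using D1[OF b line[OF b that]] DERIV_shift[of "\<lambda>s. g ((z + t *\<^sub>R b) + s *\<^sub>R b)" _ t "- t"] by simp
          then have "((\<lambda>u. g (z + u *\<^sub>R b)) has_real_derivative D1 b (z + t *\<^sub>R b)) (at t)"
            by (simp add: algebra_simps)
          moreover have "(z + u *\<^sub>R b) \<bullet> (z + u *\<^sub>R b) = z \<bullet> z + 2 * u * (z \<bullet> b) + u * u" for u
            using b by (simp add: inner_add_left inner_add_right inner_commute)
          ultimately show ?thesis
            unfolding G_def by (auto intro!: derivative_eq_intros simp: algebra_simps)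
        qed
        show "((\<lambda>t. D1 b (z + t *\<^sub>R b) + \<epsilon> * (2 * (z \<bullet> b) + 2 * t)) has_real_derivative D2 b z + 2 * \<epsilon>) (at 0)"
          using D2[OF b z\<Omega>] by (auto intro!: derivative_eq_intros)
      qed
      then have "(\<Sum>b\<in>Basis. D2 b z + 2 * \<epsilon>) \<le> 0" by (intro sum_nonpos)
      then have "(\<Sum>b\<in>Basis. D2 b z) + DIM('a) * (2 * \<epsilon>) \<le> 0"
        by (simp add: sum.distrib)
      moreover have "DIM('a) * (2 * \<epsilon>) > 0" using \<epsilon> by simp
      ultimately show False using sub[OF z\<Omega>] by linarith
    qed
    then have "g z \<le> 0" using z(1) bdry assms(1) by (simp add: frontier_def interior_open)
    moreover have "z \<bullet> z \<le> B\<^sup>2"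
      using B[OF z(1)] by (simp add: dot_square_norm power_mono)
    then have "\<epsilon> * (z \<bullet> z) \<le> \<epsilon> * B\<^sup>2" using \<epsilon> by (intro mult_left_mono) auto
    ultimately have "G z \<le> \<epsilon> * B\<^sup>2" by (simp add: G_def)
    moreover have "g x \<le> G x" using \<epsilon> by (simp add: G_def)
    moreover have "G x \<le> G z" using z(2) x closure_subset by blast
    ultimately show ?thesis by linarith
  qed
  show ?thesis
  proof (rule field_le_epsilon)
    fix e :: real assume e: "e > 0"
    have "g x \<le> e / (B\<^sup>2 + 1) * B\<^sup>2" using e by (intro bound) (simp add: add_nonneg_pos)
    also have "\<dots> \<le> e" using e add_nonneg_pos[of "B\<^sup>2" 1] by (simp add: field_simps)
    finally show "g x \<le> 0 + e" by simp
  qed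
qed

section \<open>The dipole potential\<close>

text \<open>
  Up to a constant this is the Poisson kernel of the half-space with inner unit normal \<open>e\<close> and pole at the
  origin, that is, the function \<open>(y \<bullet> e) / norm y ^ n\<close>, see \<open>dipole_eq\<close>. Writing it through \<open>y \<bullet> y\<close>
  makes it differentiable by the rules for real powers.
\<close>

definition dipole :: "'a::euclidean_space \<Rightarrow> 'a \<Rightarrow> real" where
  "dipole e y = (y \<bullet> e) * (y \<bullet> y) powr (- real DIM('a) / 2)"

text \<open>
  The derivative of the dipole potential in a coordinate direction \<open>b\<close>; \<open>dipole_d2\<close> is the second
  derivative in the same direction, see \<open>dipole_line_derivatives\<close>.
\<close>

definition dipole_d1 :: "'a::euclidean_space \<Rightarrow> 'a \<Rightarrow> 'a \<Rightarrow> real" where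
  "dipole_d1 e b y = (b \<bullet> e) * (y \<bullet> y) powr (- real DIM('a) / 2)
     - real DIM('a) * (y \<bullet> e) * (y \<bullet> b) * (y \<bullet> y) powr (- real DIM('a) / 2 - 1)"

definition dipole_d2 :: "'a::euclidean_space \<Rightarrow> 'a \<Rightarrow> 'a \<Rightarrow> real" where
  "dipole_d2 e b y =
     - real DIM('a) * (2 * ((b \<bullet> e) * (y \<bullet> b)) + y \<bullet> e) * (y \<bullet> y) powr (- real DIM('a) / 2 - 1)
     + real DIM('a) * (real DIM('a) + 2) * (y \<bullet> e) * (y \<bullet> b)\<^sup>2 * (y \<bullet> y) powr (- real DIM('a) / 2 - 2)"

lemma dipole_eq:
  fixes y :: "'a::euclidean_space"
  shows "dipole e y = (y \<bullet> e) / norm y ^ DIM('a)"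
proof (cases "y = 0")
  case False
  have "(y \<bullet> y) powr (- real DIM('a) / 2) = ((norm y) powr 2) powr (- real DIM('a) / 2)"
    using False by (simp add: dot_square_norm)
  also have "\<dots> = norm y powr (2 * (- real DIM('a) / 2))" by (rule powr_powr)
  also have "\<dots> = norm y powr (- real DIM('a))" by simp
  also have "\<dots> = 1 / norm y ^ DIM('a)"
    using False by (simp add: powr_minus powr_realpow inverse_eq_divide)
  finally show ?thesis by (simp add: dipole_def)
qed (simp add: dipole_def)

lemma DERIV_inner_self_powr:
  fixes y b :: "'a::euclidean_space"
  assumes "b \<in> Basis" "y \<noteq> 0"
  shows "((\<lambda>t. ((y + t *\<^sub>R b) \<bullet> (y + t *\<^sub>R b)) powr a) has_real_derivative
           2 * a * (y \<bullet> b) * (y \<bullet> y) powr (a - 1)) (at 0)"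
proof -
  have eq: "(y + t *\<^sub>R b) \<bullet> (y + t *\<^sub>R b) = y \<bullet> y + 2 * t * (y \<bullet> b) + t * t" for t
    using assms(1) by (simp add: inner_add_left inner_add_right inner_commute)
  have "((\<lambda>t. (y \<bullet> y + 2 * t * (y \<bullet> b) + t * t) powr a) has_real_derivative
           a * (y \<bullet> y + 2 * 0 * (y \<bullet> b) + 0 * 0) powr (a - 1) * (2 * (y \<bullet> b))) (at 0)"
    using assms(2)
    by (intro DERIV_cong[OF DERIV_fun_powr[where g = "\<lambda>t. y \<bullet> y + 2 * t * (y \<bullet> b) + t * t"]])
      (auto intro!: derivative_eq_intros)
  then show ?thesis unfolding eq by (simp add: ac_simps)
qed

lemma dipole_line_derivatives:
  fixes y b :: "'a::euclidean_space"
  assumes b: "b \<in> Basis" and y: "y \<noteq> 0"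
  shows "((\<lambda>t. dipole e (y + t *\<^sub>R b)) has_real_derivative dipole_d1 e b y) (at 0)"
    and "((\<lambda>t. dipole_d1 e b (y + t *\<^sub>R b)) has_real_derivative dipole_d2 e b y) (at 0)"
proof -
  have e: "((\<lambda>t. (y + t *\<^sub>R b) \<bullet> e) has_real_derivative b \<bullet> e) (at 0)"
    unfolding inner_add_left inner_scaleR_left by (auto intro!: derivative_eq_intros)
  have bb: "((\<lambda>t. (y + t *\<^sub>R b) \<bullet> b) has_real_derivative 1) (at 0)"
    unfolding inner_add_left inner_scaleR_left using b by (auto intro!: derivative_eq_intros)
  have n: "- real DIM('a) / 2 - 1 - 1 = - real DIM('a) / 2 - 2" by simp
  show "((\<lambda>t. dipole e (y + t *\<^sub>R b)) has_real_derivative dipole_d1 e b y) (at 0)"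
    unfolding dipole_def dipole_d1_def
    by (rule DERIV_cong[OF DERIV_mult[OF e DERIV_inner_self_powr[OF b y]]]) (simp add: algebra_simps)
  show "((\<lambda>t. dipole_d1 e b (y + t *\<^sub>R b)) has_real_derivative dipole_d2 e b y) (at 0)"
    unfolding dipole_d1_def
    by (rule DERIV_cong[OF DERIV_diff[OF DERIV_cmult[OF DERIV_inner_self_powr[OF b y]]
        DERIV_mult[OF DERIV_mult[OF DERIV_cmult[OF e] bb] DERIV_inner_self_powr[OF b y]]]],
        simp only: dipole_d2_def n scaleR_zero_left add_0_right)
      (simp add: algebra_simps power2_eq_square)
qed

text \<open>
  The two sums over the basis are \<open>y \<bullet> e\<close> and \<open>y \<bullet> y\<close>, so that the coefficients of
  \<open>(y \<bullet> e) * (y \<bullet> y) powr (- n / 2 - 1)\<close> add up to \<open>- 2 * n - n\<^sup>2 + n * (n + 2) = 0\<close>.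
\<close>

lemma dipole_harmonic:
  fixes y :: "'a::euclidean_space"
  assumes "y \<noteq> 0"
  shows "(\<Sum>b\<in>Basis. dipole_d2 e b y) = 0"
proof -
  let ?n = "real DIM('a)" and ?p = "(y \<bullet> y) powr (- real DIM('a) / 2 - 1)"
    and ?q = "(y \<bullet> y) powr (- real DIM('a) / 2 - 2)"
  have ye: "(\<Sum>b\<in>Basis. (b \<bullet> e) * (y \<bullet> b)) = y \<bullet> e"
    by (subst euclidean_inner[of y e]) (simp add: inner_commute mult.commute)
  have yy: "(\<Sum>b\<in>Basis. (y \<bullet> b)\<^sup>2) = y \<bullet> y"
    by (subst euclidean_inner[of y y]) (simp add: power2_eq_square)
  have q: "(y \<bullet> y) * ?q = ?p"
  proof -
    have "1 + (- ?n / 2 - 2) = - ?n / 2 - 1" by simp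
    then show ?thesis using powr_mult_base[of "y \<bullet> y" "- ?n / 2 - 2"] by (metis inner_ge_zero)
  qed
  have "(\<Sum>b\<in>Basis. dipole_d2 e b y)
      = (- ?n * ?p) * (2 * (\<Sum>b\<in>Basis. (b \<bullet> e) * (y \<bullet> b)) + ?n * (y \<bullet> e))
        + ?n * (?n + 2) * (y \<bullet> e) * ?q * (\<Sum>b\<in>Basis. (y \<bullet> b)\<^sup>2)"
  proof -
    have "dipole_d2 e b y = (- ?n * ?p * 2) * ((b \<bullet> e) * (y \<bullet> b)) + (- ?n * ?p * (y \<bullet> e))
        + (?n * (?n + 2) * (y \<bullet> e) * ?q) * (y \<bullet> b)\<^sup>2" for b
      by (simp add: dipole_d2_def algebra_simps)
    then have "(\<Sum>b\<in>Basis. dipole_d2 e b y)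
        = (- ?n * ?p * 2) * (\<Sum>b\<in>Basis. (b \<bullet> e) * (y \<bullet> b)) + ?n * (- ?n * ?p * (y \<bullet> e))
          + (?n * (?n + 2) * (y \<bullet> e) * ?q) * (\<Sum>b\<in>Basis. (y \<bullet> b)\<^sup>2)"
      by (simp only: sum.distrib sum_distrib_left sum_constant)
    then show ?thesis by (simp only: distrib_left ac_simps)
  qed
  also have "\<dots> = (- ?n * ?p) * (2 * (y \<bullet> e) + ?n * (y \<bullet> e)) + ?n * (?n + 2) * (y \<bullet> e) * ((y \<bullet> y) * ?q)"
    unfolding ye yy by (simp only: ac_simps)
  also have "\<dots> = 0" unfolding q by (simp add: algebra_simps)
  finally show ?thesis .
qed

lemma continuous_on_dipole:
  assumes "q \<notin> S"
  shows "continuous_on S (\<lambda>x. dipole e (x - q))"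
  unfolding dipole_eq using assms by (intro continuous_intros) auto

text \<open>
  The barrier property. With the pole moved from \<open>p\<close> outwards by \<open>r\<close>, points within distance \<open>r\<close> of
  \<open>p\<close> on the inner side have height at least \<open>r\<close> over the pole and distance at most \<open>2 * r\<close> from it.
\<close>

lemma dipole_ge_near_pole:
  fixes e p x :: "'a::euclidean_space"
  assumes "norm e = 1" "0 < r" "dist p x < r" "0 \<le> (x - p) \<bullet> e"
  shows "1 \<le> 2 ^ DIM('a) * (r ^ (DIM('a) - 1) * dipole e (x - (p - r *\<^sub>R e)))"
proof -
  define y where "y = x - (p - r *\<^sub>R e)"
  have e1: "e \<bullet> e = 1" using assms(1) by (simp add: dot_square_norm)
  have y: "y = (x - p) + r *\<^sub>R e" by (simp add: y_def)
  have ye: "r \<le> y \<bullet> e" using assms(4) e1 unfolding y inner_add_left by simp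
  have "norm y \<le> norm (x - p) + norm (r *\<^sub>R e)" unfolding y by (rule norm_triangle_ineq)
  also have "\<dots> \<le> 2 * r" using assms by (simp add: dist_norm norm_minus_commute)
  finally have ny: "norm y \<le> 2 * r" .
  have y0: "y \<noteq> 0" using ye assms(2) by auto
  have "norm y ^ DIM('a) \<le> (2 * r) ^ DIM('a)" using ny by (intro power_mono) auto
  also have "\<dots> = 2 ^ DIM('a) * (r ^ (DIM('a) - 1) * r)"
    using power_minus_mult[OF DIM_positive[where 'a='a], of r] by (simp add: power_mult_distrib)
  also have "\<dots> \<le> 2 ^ DIM('a) * (r ^ (DIM('a) - 1) * (y \<bullet> e))"
    using ye assms(2) by (intro mult_left_mono) auto
  finally have "1 \<le> 2 ^ DIM('a) * (r ^ (DIM('a) - 1) * (y \<bullet> e)) / norm y ^ DIM('a)"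
    using y0 by simp
  then show ?thesis unfolding y_def[symmetric] dipole_eq by simp
qed

lemma abs_dipole_le:
  fixes e y :: "'a::euclidean_space"
  assumes "norm e = 1"
  shows "\<bar>dipole e y\<bar> \<le> 1 / norm y ^ (DIM('a) - 1)"
proof (cases "y = 0")
  case False
  have "\<bar>y \<bullet> e\<bar> \<le> norm y" using Cauchy_Schwarz_ineq2[of y e] assms by simp
  then have "\<bar>dipole e y\<bar> \<le> norm y / norm y ^ DIM('a)"
    unfolding dipole_eq abs_divide by (simp add: divide_right_mono)
  also have "norm y ^ DIM('a) = norm y ^ (DIM('a) - 1) * norm y"
    using power_minus_mult[OF DIM_positive[where 'a='a], of "norm y"] by simp
  finally show ?thesis using False by simp
qed (simp add: dipole_def)

section \<open>The integral inequality\<close>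

lemma Ck_on_2_line_derivatives:
  fixes f :: "'a::euclidean_space \<Rightarrow> real"
  assumes "Ck_on 2 f \<Omega>" "b \<in> Basis" "x \<in> \<Omega>"
  shows "((\<lambda>t. f (x + t *\<^sub>R b)) has_real_derivative partial_deriv b f x) (at 0)"
    and "((\<lambda>t. partial_deriv b f (x + t *\<^sub>R b)) has_real_derivative partial_deriv b (partial_deriv b f) x) (at 0)"
proof -
  have "(\<lambda>t. f (x + t *\<^sub>R b)) differentiable (at 0)"
    "(\<lambda>t. partial_deriv b f (x + t *\<^sub>R b)) differentiable (at 0)"
    using assms by (auto simp: numeral_2_eq_2)
  then show "((\<lambda>t. f (x + t *\<^sub>R b)) has_real_derivative partial_deriv b f x) (at 0)"
    "((\<lambda>t. partial_deriv b f (x + t *\<^sub>R b)) has_real_derivative partial_deriv b (partial_deriv b f) x) (at 0)"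
    unfolding partial_deriv_def by (simp_all add: DERIV_deriv_iff_real_differentiable)
qed

lemma dipole_integral_le:
  fixes \<Omega> :: "'a::euclidean_space set"
  assumes "open \<Omega>" and q: "q \<notin> closure \<Omega>" and e: "norm e = 1"
    and pos: "\<And>x. x \<in> \<Omega> \<Longrightarrow> 0 \<le> dipole e (x - q)"
    and R: "R > 0" and vol: "emeasure (hausdorff_measure DIM('a)) \<Omega> \<le> ennreal (R ^ DIM('a))"
    and C: "C \<ge> 0" and ball: "\<And>s. s > 0 \<Longrightarrow> hausdorff_outer DIM('a) (cball q s) \<le> ennreal (C * s ^ DIM('a))"
  shows "set_integrable (hausdorff_measure DIM('a)) \<Omega> (\<lambda>x. dipole e (x - q))"
    and "(LINT x:\<Omega>|hausdorff_measure DIM('a). dipole e (x - q)) \<le> (1 + 2 ^ DIM('a) * C) * R"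
proof -
  let ?M = "hausdorff_measure DIM('a) :: 'a measure"
  let ?g = "\<lambda>x. indicator \<Omega> x *\<^sub>R dipole e (x - q)"
  have q': "q \<notin> \<Omega>" using q closure_subset by blast
  have meas: "?g \<in> borel_measurable ?M"
    using borel_measurable_continuous_on_indicator[OF _ continuous_on_dipole[OF q', of e]] assms(1)
    by (simp cong: measurable_cong_sets)
  have g0: "0 \<le> ?g x" for x using pos by (auto simp: indicator_def)
  have "(\<integral>\<^sup>+x. ennreal (?g x) \<partial>?M) \<le> (\<integral>\<^sup>+x\<in>\<Omega>. ennreal (1 / dist x q ^ (DIM('a) - 1)) \<partial>?M)"
  proof (intro nn_integral_mono)
    fix x
    show "ennreal (?g x) \<le> ennreal (1 / dist x q ^ (DIM('a) - 1)) * indicator \<Omega> x"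
      using abs_dipole_le[OF e, of "x - q"]
      by (cases "x \<in> \<Omega>") (auto simp: dist_norm intro!: ennreal_leI)
  qed
  also have "\<dots> \<le> ennreal ((1 + 2 ^ DIM('a) * C) * R)"
    using ball assms(1) by (intro nn_integral_dist_power_le q' R vol C) (auto simp: emeasure_hausdorff_measure)
  finally have le: "(\<integral>\<^sup>+x. ennreal (?g x) \<partial>?M) \<le> ennreal ((1 + 2 ^ DIM('a) * C) * R)" .
  show int: "set_integrable ?M \<Omega> (\<lambda>x. dipole e (x - q))"
    unfolding set_integrable_def
    using meas g0 le by (intro integrableI_nonneg) (auto intro: le_less_trans)
  have "ennreal (LINT x|?M. ?g x) \<le> ennreal ((1 + 2 ^ DIM('a) * C) * R)"
    using le nn_integral_eq_integral[OF int[unfolded set_integrable_def]] g0 by simp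
  then show "(LINT x:\<Omega>|?M. dipole e (x - q)) \<le> (1 + 2 ^ DIM('a) * C) * R"
    unfolding set_lebesgue_integral_def
    using R C by (subst (asm) ennreal_le_iff) auto
qed

text \<open>
  The factors of the constant \<open>A * B\<close> are the integral bound for a dipole, together with
  the \<open>2 ^ n\<close> from its lower bound near the pole, and the constant of the covering lemma.
\<close>

theorem hermite_hadamard_subharmonic:
  assumes dim: "DIM('a::euclidean_space) \<ge> 2"
  shows "\<exists>c::real. \<forall>(\<Omega> :: 'a set) (f :: 'a \<Rightarrow> real).
    open \<Omega> \<and> bounded \<Omega> \<and> convex \<Omega> \<and>
    continuous_on (closure \<Omega>) f \<and> Ck_on 2 f \<Omega> \<and>
    (\<forall>x\<in>\<Omega>. laplacian f x \<ge> 0) \<and> (\<forall>x\<in>frontier \<Omega>. f x \<ge> 0) \<longrightarrow>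
    (LINT x:\<Omega>|hausdorff_measure DIM('a). f x)
      \<le> c * measure (hausdorff_measure DIM('a)) \<Omega> powr (1 / real DIM('a))
          * (LINT x:frontier \<Omega>|hausdorff_measure (DIM('a) - 1). f x)"
proof -
  define n where "n = DIM('a)"
  define k where "k = n - 1"
  have k: "k > 0" and n: "n > 0" using dim by (auto simp: k_def n_def)
  obtain C where C: "C \<ge> 0"
    and ball: "\<And>(q::'a) s. s > 0 \<Longrightarrow> hausdorff_outer n (cball q s) \<le> ennreal (C * s ^ n)"
    using hausdorff_outer_cball_le[where 'a='a] unfolding n_def by blast
  define A where "A = 2 ^ n * (1 + 2 ^ n * C)"
  have A: "A \<ge> 0" using C by (simp add: A_def)
  define B where "B = 4 ^ k / unit_ball_vol (real k)"
  have B: "B \<ge> 0" by (simp add: B_def)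
  let ?M = "hausdorff_measure n :: 'a measure" and ?S = "hausdorff_measure k :: 'a measure"
  have main: "(LINT x:\<Omega>|?M. f x) \<le> A * B * measure ?M \<Omega> powr (1 / real n) * (LINT x:frontier \<Omega>|?S. f x)"
    if "open \<Omega>" "bounded \<Omega>" "convex \<Omega>" and cont: "continuous_on (closure \<Omega>) f" and C2: "Ck_on 2 f \<Omega>"
      and lap: "\<And>x. x \<in> \<Omega> \<Longrightarrow> laplacian f x \<ge> 0" and bdry: "\<And>x. x \<in> frontier \<Omega> \<Longrightarrow> f x \<ge> 0"
    for \<Omega> :: "'a set" and f
  proof -
    have frc: "frontier \<Omega> \<subseteq> closure \<Omega>" by (simp add: frontier_def)
    have contK: "continuous_on (frontier \<Omega>) f" by (rule continuous_on_subset[OF cont frc])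
    have compK: "compact (frontier \<Omega>)" using \<open>bounded \<Omega>\<close> by (rule compact_frontier_bounded)
    have Kb: "frontier \<Omega> \<in> sets borel" using compK by (simp add: borel_compact)
    have finK: "hausdorff_outer k (frontier \<Omega>) < \<infinity>"
      unfolding k_def n_def using that(3,1,2) by (rule hausdorff_outer_frontier_convex_finite)
    have emK: "emeasure ?S (frontier \<Omega>) < \<infinity>"
      using finK Kb by (simp add: emeasure_hausdorff_measure)
    define I where "I = (LINT x:frontier \<Omega>|?S. f x)"
    obtain s0 where s0: "s0 > 0" "\<Omega> \<subseteq> cball 0 s0"
      using bounded_subset_ballD[OF \<open>bounded \<Omega>\<close>, of 0] ball_subset_cball by blast
    have em\<Omega>: "emeasure ?M \<Omega> < \<infinity>"
    proof -
      have "emeasure ?M \<Omega> \<le> hausdorff_outer n (cball (0 :: 'a) s0)"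
        using that(1) s0(2) by (simp add: emeasure_hausdorff_measure hausdorff_outer_mono)
      also have "\<dots> < \<infinity>" using ball[OF s0(1), of 0] by (rule le_less_trans) simp
      finally show ?thesis .
    qed
    define R where "R = measure ?M \<Omega> powr (1 / real n)"
    show ?thesis
    \<comment> \<open>Both sides vanish for a null domain. Treating this case directly spares a lower bound for the
      Hausdorff measure of open sets.\<close>
    proof (cases "measure ?M \<Omega> = 0")
      case True
      then have "\<Omega> \<in> null_sets ?M"
        using em\<Omega> \<open>open \<Omega>\<close> by (auto simp: null_sets_def emeasure_eq_ennreal_measure)
      then have "(LINT x:\<Omega>|?M. f x) = 0"
        unfolding set_lebesgue_integral_def
        by (intro integral_eq_zero_AE) (auto dest!: AE_not_in simp: indicator_def elim: eventually_mono)
      then show ?thesis using True by simp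
    next
      case False
      then have R: "R > 0" by (simp add: R_def)
      have "R ^ n = measure ?M \<Omega>"
        using False n by (simp add: R_def powr_powr flip: powr_realpow)
      then have vol: "emeasure ?M \<Omega> \<le> ennreal (R ^ n)"
        using em\<Omega> by (simp add: emeasure_eq_ennreal_measure)
      \<comment> \<open>The boundary values are raised by \<open>\<epsilon>\<close> because the value of \<open>f\<close> at the centre of a small ball
        dominates its values on the ball only up to \<open>\<epsilon>\<close>.\<close>
      have approx: "(LINT x:\<Omega>|?M. f x) \<le> A * R * (B * (I + \<epsilon> * measure ?S (frontier \<Omega>)) + \<epsilon>)"
        if \<epsilon>: "\<epsilon> > 0" for \<epsilon>
      proof -
        obtain \<delta> where \<delta>: "\<delta> > 0"
          "\<And>x p. x \<in> frontier \<Omega> \<Longrightarrow> p \<in> frontier \<Omega> \<Longrightarrow> dist x p < \<delta> \<Longrightarrow> dist (f x) (f p) < \<epsilon>"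
          using compact_uniformly_continuous[OF contK compK] \<epsilon> unfolding uniformly_continuous_on_def by blast
        have contK': "continuous_on (frontier \<Omega>) (\<lambda>x. f x + \<epsilon>)" using contK by (intro continuous_intros)
        obtain F where F: "finite F" "F \<subseteq> frontier \<Omega> \<times> {0<..<\<delta>}" "frontier \<Omega> \<subseteq> (\<Union>(p, r)\<in>F. ball p r)"
          "(\<Sum>(p, r)\<in>F. (f p + \<epsilon>) * r ^ k) \<le> B * (LINT x:frontier \<Omega>|?S. f x + \<epsilon>) + \<epsilon>"
          using exists_ball_cover_sum_le_integral[OF k compK finK contK' _ \<delta>(1) \<epsilon>] bdry \<epsilon>
          unfolding B_def by (metis add_nonneg_nonneg less_imp_le)
        have "(LINT x:frontier \<Omega>|?S. f x + \<epsilon>) = I + \<epsilon> * measure ?S (frontier \<Omega>)"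
        proof -
          obtain b where "\<And>x. x \<in> frontier \<Omega> \<Longrightarrow> \<bar>f x\<bar> \<le> b"
            using compact_imp_bounded[OF compact_continuous_image[OF contK compK]] by (auto simp: bounded_iff)
          then have "set_integrable ?S (frontier \<Omega>) f"
            by (rule set_integrable_hausdorff_measure[OF Kb contK _ emK])
          moreover have "set_integrable ?S (frontier \<Omega>) (\<lambda>x. \<epsilon>)"
            by (rule set_integrable_hausdorff_measure[OF Kb _ _ emK]) auto
          moreover have "(LINT x:frontier \<Omega>|?S. \<epsilon>) = \<epsilon> * measure ?S (frontier \<Omega>)"
            using Kb emK by (simp add: set_lebesgue_integral_def mult.commute)
          ultimately show ?thesis by (simp add: set_integral_add I_def)
        qed
        note sum_F = F(4)[unfolded this]
        have Fp: "fst s \<in> frontier \<Omega>" "0 < snd s" "snd s < \<delta>" if "s \<in> F" for s using F(2) that by auto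
        have "\<exists>e. norm e = 1 \<and> (\<forall>y\<in>closure \<Omega>. 0 \<le> (y - p) \<bullet> e)" if "p \<in> frontier \<Omega>" for p
          using supporting_normal[OF \<open>convex \<Omega>\<close> \<open>open \<Omega>\<close> that] by metis
        then obtain e where e: "\<And>p. p \<in> frontier \<Omega> \<Longrightarrow> norm (e p) = 1"
          "\<And>p y. p \<in> frontier \<Omega> \<Longrightarrow> y \<in> closure \<Omega> \<Longrightarrow> 0 \<le> (y - p) \<bullet> e p"
          by metis
        \<comment> \<open>The comparison function \<open>V\<close> has one dipole for each ball of the cover. All poles lie
          outside the closure, since the supporting half-spaces keep them at height \<open>snd s\<close> below it.\<close>
        define q where "q s = fst s - snd s *\<^sub>R e (fst s)" for s
        define h where "h s = 2 ^ n * ((f (fst s) + \<epsilon>) * snd s ^ k)" for s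
        define v where "v s x = dipole (e (fst s)) (x - q s)" for s x
        define V where "V x = (\<Sum>s\<in>F. h s * v s x)" for x
        have h: "h s \<ge> 0" if "s \<in> F" for s
          using Fp[OF that] bdry \<epsilon> by (simp add: h_def add_nonneg_nonneg)
        have above: "(x - q s) \<bullet> e (fst s) \<ge> snd s" if "s \<in> F" "x \<in> closure \<Omega>" for s x
          using e[OF Fp(1)[OF that(1)]] that(2)
          by (simp add: q_def inner_diff_left inner_add_left dot_square_norm algebra_simps)
        have qn: "q s \<notin> closure \<Omega>" if "s \<in> F" for s
          using above[OF that] Fp(2)[OF that] by force
        have v: "v s x \<ge> 0" if "s \<in> F" "x \<in> closure \<Omega>" for s x
          using above[OF that] Fp(2)[OF that(1)] by (simp add: v_def dipole_eq)
        have contV: "continuous_on (closure \<Omega>) V"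
          unfolding V_def v_def using qn by (intro continuous_intros continuous_on_dipole)
        \<comment> \<open>At a frontier point a single dipole, that of a ball containing it, already dominates \<open>f\<close>.\<close>
        have fV: "f x - V x \<le> 0" if x: "x \<in> frontier \<Omega>" for x
        proof -
          obtain s where s: "s \<in> F" "dist (fst s) x < snd s"
            using F(3) x by fastforce
          have "dist (f x) (f (fst s)) < \<epsilon>"
            using \<delta>(2)[OF x Fp(1)[OF s(1)]] s(2) Fp(3)[OF s(1)] by (simp add: dist_commute)
          then have "f x \<le> (f (fst s) + \<epsilon>) * 1" by (simp add: dist_real_def)
          also have "\<dots> \<le> (f (fst s) + \<epsilon>) * (2 ^ n * (snd s ^ k * v s x))"
            using dipole_ge_near_pole[OF e(1)[OF Fp(1)[OF s(1)]] Fp(2)[OF s(1)] s(2)]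
              e(2)[OF Fp(1)[OF s(1)]] x frc bdry[OF Fp(1)[OF s(1)]] \<epsilon>
            by (intro mult_left_mono) (auto simp: v_def q_def n_def k_def)
          also have "\<dots> = h s * v s x" by (simp add: h_def)
          also have "\<dots> \<le> V x"
            unfolding V_def using F(1) s(1) h v x frc by (intro member_le_sum) auto
          finally show ?thesis by simp
        qed
        have le: "f x - V x \<le> 0" if x: "x \<in> \<Omega>" for x
        proof (rule subharmonic_le_0_of_frontier_le_0[OF \<open>open \<Omega>\<close> \<open>bounded \<Omega>\<close> _ _ _ _ fV x])
          show "continuous_on (closure \<Omega>) (\<lambda>x. f x - V x)" by (intro continuous_intros cont contV)
          fix b x assume b: "b \<in> (Basis :: 'a set)" and x: "x \<in> \<Omega>"
          have nq: "x - q s \<noteq> 0" if "s \<in> F" for s using qn[OF that] x closure_subset by auto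
          have sh: "x + t *\<^sub>R b - q s = (x - q s) + t *\<^sub>R b" for t s by simp
          show "((\<lambda>t. f (x + t *\<^sub>R b) - V (x + t *\<^sub>R b)) has_real_derivative
              partial_deriv b f x - (\<Sum>s\<in>F. h s * dipole_d1 (e (fst s)) b (x - q s))) (at 0)"
            unfolding V_def v_def sh
            by (intro DERIV_diff DERIV_sum DERIV_cmult Ck_on_2_line_derivatives[OF C2 b x]
                dipole_line_derivatives b nq)
          show "((\<lambda>t. partial_deriv b f (x + t *\<^sub>R b) - (\<Sum>s\<in>F. h s * dipole_d1 (e (fst s)) b (x + t *\<^sub>R b - q s)))
              has_real_derivative
              partial_deriv b (partial_deriv b f) x - (\<Sum>s\<in>F. h s * dipole_d2 (e (fst s)) b (x - q s))) (at 0)"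
            unfolding sh
            by (intro DERIV_diff DERIV_sum DERIV_cmult Ck_on_2_line_derivatives[OF C2 b x]
                dipole_line_derivatives b nq)
        next
          fix x assume x: "x \<in> \<Omega>"
          have nq: "x - q s \<noteq> 0" if "s \<in> F" for s using qn[OF that] x closure_subset by auto
          have "(\<Sum>b\<in>Basis. \<Sum>s\<in>F. h s * dipole_d2 (e (fst s)) b (x - q s))
              = (\<Sum>s\<in>F. h s * (\<Sum>b\<in>Basis. dipole_d2 (e (fst s)) b (x - q s)))"
            by (subst sum.swap) (simp add: sum_distrib_left)
          also have "\<dots> = 0" using dipole_harmonic[OF nq] by simp
          finally show "0 \<le> (\<Sum>b\<in>Basis. partial_deriv b (partial_deriv b f) x
              - (\<Sum>s\<in>F. h s * dipole_d2 (e (fst s)) b (x - q s)))"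
            using lap[OF x] by (simp add: sum_subtractf laplacian_def)
        qed
        have intv: "set_integrable ?M \<Omega> (v s)"
          and lev: "(LINT x:\<Omega>|?M. v s x) \<le> (1 + 2 ^ n * C) * R" if s: "s \<in> F" for s
        proof -
          have "0 \<le> dipole (e (fst s)) (x - q s)" if "x \<in> \<Omega>" for x
            using v[OF s] closure_subset that by (auto simp: v_def)
          note * = dipole_integral_le[OF \<open>open \<Omega>\<close> qn[OF s] e(1)[OF Fp(1)[OF s]] this R
              vol[unfolded n_def] C ball[unfolded n_def]]
          show "set_integrable ?M \<Omega> (v s)" "(LINT x:\<Omega>|?M. v s x) \<le> (1 + 2 ^ n * C) * R"
            using * unfolding v_def n_def by auto
        qed
        have V_sum: "indicator \<Omega> x *\<^sub>R V x = (\<Sum>s\<in>F. h s * (indicator \<Omega> x *\<^sub>R v s x))" for x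
          by (simp add: V_def sum_distrib_left ac_simps)
        have intV: "set_integrable ?M \<Omega> V"
          using intv unfolding set_integrable_def V_sum
          by (intro Bochner_Integration.integrable_sum integrable_mult_right)
        have "(LINT x:\<Omega>|?M. f x) \<le> (LINT x:\<Omega>|?M. V x)"
          unfolding set_lebesgue_integral_def
        proof (rule integral_mono'[OF intV[unfolded set_integrable_def]])
          fix x
          show "indicator \<Omega> x *\<^sub>R f x \<le> indicator \<Omega> x *\<^sub>R V x"
            using le[of x] by (auto simp: indicator_def)
          show "0 \<le> indicator \<Omega> x *\<^sub>R V x"
            using h v subsetD[OF closure_subset, of x \<Omega>]
            by (auto simp: indicator_def V_def intro!: sum_nonneg mult_nonneg_nonneg)
        qed
        also have "\<dots> = (\<Sum>s\<in>F. h s * (LINT x:\<Omega>|?M. v s x))"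
          using intv unfolding set_lebesgue_integral_def set_integrable_def V_sum
          by (subst Bochner_Integration.integral_sum) auto
        also have "\<dots> \<le> (\<Sum>s\<in>F. h s * ((1 + 2 ^ n * C) * R))"
          using h lev by (intro sum_mono mult_left_mono)
        also have "\<dots> = A * R * (\<Sum>(p, r)\<in>F. (f p + \<epsilon>) * r ^ k)"
          by (simp add: h_def A_def sum_distrib_left case_prod_unfold ac_simps)
        also have "\<dots> \<le> A * R * (B * (I + \<epsilon> * measure ?S (frontier \<Omega>)) + \<epsilon>)"
          using sum_F A R by (intro mult_left_mono) auto
        finally show ?thesis .
      qed
      have "(LINT x:\<Omega>|?M. f x) \<le> A * B * R * I"
      proof (rule field_le_epsilon)
        fix \<eta> :: real assume \<eta>: "\<eta> > 0"
        define D where "D = A * R * (B * measure ?S (frontier \<Omega>) + 1)"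
        have D: "D \<ge> 0" using A B R by (simp add: D_def)
        define \<epsilon> where "\<epsilon> = \<eta> / (D + 1)"
        have "(LINT x:\<Omega>|?M. f x) \<le> A * R * (B * (I + \<epsilon> * measure ?S (frontier \<Omega>)) + \<epsilon>)"
          using \<eta> D by (intro approx) (simp add: \<epsilon>_def)
        also have "\<dots> = A * B * R * I + \<epsilon> * D" by (simp add: D_def algebra_simps)
        also have "\<epsilon> * D \<le> \<eta>" using \<eta> D by (simp add: \<epsilon>_def field_simps)
        finally show "(LINT x:\<Omega>|?M. f x) \<le> A * B * R * I + \<eta>" by simp
      qed
      then show ?thesis by (simp add: R_def I_def)
    qed
  qed
  show ?thesis
    using main unfolding k_def n_def by (intro exI[of _ "A * B"]) (auto simp: n_def k_def)
qed

theorem theorem3: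
  assumes "CARD('n::finite) \<ge> 3"
  shows "\<exists>c::real. \<forall>(\<Omega> :: (real ^ 'n) set) (f :: real ^ 'n \<Rightarrow> real).
    \<Omega> \<noteq> {} \<and> open \<Omega> \<and> connected \<Omega> \<and> bounded \<Omega> \<and> convex \<Omega> \<and>
    continuous_on (closure \<Omega>) f \<and> Ck_on 2 f \<Omega> \<and>
    (\<forall>x\<in>\<Omega>. laplacian f x \<ge> 0) \<and> (\<forall>x\<in>frontier \<Omega>. f x \<ge> 0) \<longrightarrow>
    (LINT x:\<Omega>|hausdorff_measure CARD('n). f x)
      \<le> c * measure (hausdorff_measure CARD('n)) \<Omega> powr (1 / real CARD('n))
          * (LINT x:frontier \<Omega>|hausdorff_measure (CARD('n) - 1). f x)"
proof -
  have dim: "DIM(real ^ 'n) = CARD('n)" by simp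
  have "DIM(real ^ 'n) \<ge> 2" using assms by simp
  from hermite_hadamard_subharmonic[OF this, unfolded dim] show ?thesis
    by (rule ex_forward) (intro allI impI, drule spec, drule spec, erule mp, intro conjI; elim conjE; assumption)
qed

end
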